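(* Let $k$ be a perfect field of characteristic $p>0$ and $S=k[x_1,\dots,x_N]$. For all $a\in S$ and all $s\ge1$, $$\Delta_s(a)\equiv a^{p^s-p}\,\Delta_1(a)\mod F(S).$$
   Context: $F(S)=\{b^p\mid b\in S\}$ is the image of Frobenius. $W(S)$ is the ring of ($p$-typical) Witt vectors and $[a]=(a,0,0,\dots)$ the Teichmüller lift. For $a\in S$ take the monomial decomposition $a=\sum_iM_i$ (each $M_i$ a scalar times a monic monomial, the monic monomials distinct), and define $\delta_i(a)\in S$ for $i\ge1$ by $$(0,\delta_1(a),\delta_2(a),\dots)=[a]-\sum_i[M_i]\quad\text{in }W(S).$$ The maps $\Delta_s\colon S\to S$ are defined inductively by $\Delta_1:=\delta_1$ and $$\Delta_s(a):=\sum_{r=1}^{s-1}\Delta_r(\delta_{s-r}(a))+\delta_s(a).$$ *)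

theory Defs
  imports "HOL-Library.Poly_Mapping" "HOL-Algebra.Ring"
begin

text \<open>
  A multivariate polynomial is a finitely supported function from exponent vectors to
  coefficients, with the convolution product of \<^theory>\<open>HOL-Library.Poly_Mapping\<close>.
\<close>

type_synonym ('v, 'c) mpoly = "('v \<Rightarrow>\<^sub>0 nat) \<Rightarrow>\<^sub>0 'c"

definition mpoly_var :: "'v \<Rightarrow> ('v, 'c::comm_ring_1) mpoly" where
  "mpoly_var v = Poly_Mapping.single (Poly_Mapping.single v 1) 1"

definition mpoly_eval :: "('v \<Rightarrow> 'a::comm_ring_1) \<Rightarrow> ('v, int) mpoly \<Rightarrow> 'a" where
  "mpoly_eval x f =
     (\<Sum>m\<in>Poly_Mapping.keys f. of_int (Poly_Mapping.lookup f m) *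
        (\<Prod>v\<in>Poly_Mapping.keys m. x v ^ Poly_Mapping.lookup m v))"

text \<open>The polynomial ring in the variables \<open>x\<^sub>1, \<dots>, x\<^sub>N\<close>, inside the polynomials in all
  variables indexed by natural numbers.\<close>

definition poly_ring :: "nat \<Rightarrow> (nat, 'k::comm_ring_1) mpoly set" where
  "poly_ring N = {f. \<forall>m\<in>Poly_Mapping.keys f. Poly_Mapping.keys m \<subseteq> {1..N}}"

definition frobenius_image :: "nat \<Rightarrow> 'a::comm_ring_1 set \<Rightarrow> 'a set" where
  "frobenius_image p S = {b ^ p | b. b \<in> S}"


definition ghost :: "nat \<Rightarrow> nat \<Rightarrow> (nat \<Rightarrow> 'a::comm_ring_1) \<Rightarrow> 'a" where
  "ghost p n x = (\<Sum>i\<le>n. of_nat (p ^ i) * x i ^ (p ^ (n - i)))"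

text \<open>
  The universal sum and product polynomials: by Witt's theorem, for prime \<open>p\<close> the ghost
  equations have exactly one solution over the integers. The variables \<open>Inl i\<close> and
  \<open>Inr i\<close> stand for the \<open>i\<close>-th components of the two operands.
\<close>

definition witt_add_poly :: "nat \<Rightarrow> nat \<Rightarrow> (nat + nat, int) mpoly" where
  "witt_add_poly p = (THE \<phi>. \<forall>n. ghost p n \<phi> =
     ghost p n (\<lambda>i. mpoly_var (Inl i)) + ghost p n (\<lambda>i. mpoly_var (Inr i)))"

definition witt_mult_poly :: "nat \<Rightarrow> nat \<Rightarrow> (nat + nat, int) mpoly" where
  "witt_mult_poly p = (THE \<phi>. \<forall>n. ghost p n \<phi> =
     ghost p n (\<lambda>i. mpoly_var (Inl i)) * ghost p n (\<lambda>i. mpoly_var (Inr i)))"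

definition teichmueller :: "'a::comm_ring_1 \<Rightarrow> nat \<Rightarrow> 'a" where
  "teichmueller a = (\<lambda>i. if i = 0 then a else 0)"

text \<open>The ring \<open>W(S)\<close> for a subring \<open>S\<close> of the ring given by the type.\<close>

definition witt_ring :: "nat \<Rightarrow> 'a::comm_ring_1 set \<Rightarrow> (nat \<Rightarrow> 'a) ring" where
  "witt_ring p S =
     \<lparr> carrier = {x. \<forall>i. x i \<in> S},
       mult = (\<lambda>x y n. mpoly_eval (case_sum x y) (witt_mult_poly p n)),
       one = teichmueller 1,
       zero = (\<lambda>_. 0),
       add = (\<lambda>x y n. mpoly_eval (case_sum x y) (witt_add_poly p n)) \<rparr>"


text \<open>The component of index 0 is included; it vanishes.\<close>

definition witt_delta ::
  "nat \<Rightarrow> (nat, 'k::comm_ring_1) mpoly set \<Rightarrow> nat \<Rightarrow> (nat, 'k) mpoly \<Rightarrow> (nat, 'k) mpoly" where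
  "witt_delta p S i a =
     (teichmueller a \<ominus>\<^bsub>witt_ring p S\<^esub>
       (\<Oplus>\<^bsub>witt_ring p S\<^esub>m\<in>Poly_Mapping.keys a.
          teichmueller (Poly_Mapping.single m (Poly_Mapping.lookup a m)))) i"

text \<open>Only \<open>s \<ge> 1\<close> is meaningful; for \<open>s = 1\<close> the sum is empty.\<close>

fun witt_Delta ::
  "nat \<Rightarrow> (nat, 'k::comm_ring_1) mpoly set \<Rightarrow> nat \<Rightarrow> (nat, 'k) mpoly \<Rightarrow> (nat, 'k) mpoly" where
  "witt_Delta p S s a =
     (\<Sum>r\<in>{1..<s}. witt_Delta p S r (witt_delta p S (s - r) a)) + witt_delta p S s a"

declare witt_Delta.simps [simp del]

lemma witt_Delta_1: "witt_Delta p S 1 a = witt_delta p S 1 a"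
  by (subst witt_Delta.simps) simp

end

theory Submission
  imports Defs "HOL-Computational_Algebra.Primes"
begin

text \<open>
  Iterating \<open>[a] = \<Sum>[M\<^sub>i] + \<Sum>V\<^sup>i[\<delta>\<^sub>i(a)]\<close> gives \<open>[a] = \<Sum>\<^sub>s V\<^sup>s A\<^sub>s\<close> with all \<open>A\<^sub>s\<close> in the image \<open>T\<close> of
  \<open>W(k)[x\<^sub>1, \<dots>, x\<^sub>N]\<close> in \<open>W(S)\<close>, where \<open>A\<^sub>0 = \<Sum>[M\<^sub>i]\<close> and \<open>A\<^sub>s\<close> lifts \<open>\<Delta>\<^sub>s(a)\<close>. Since \<open>FV = p\<close>, applying
  \<open>F\<^sup>n\<close> yields \<open>[a]\<^sup>q \<equiv> F(y) + q A\<^sub>n\<close> modulo \<open>q V W(S)\<close>, with \<open>q = p\<^sup>n\<close> and \<open>y \<in> T\<close>. On the other hand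
  \<open>[a]\<^sup>q \<equiv> A\<^sub>0\<^sup>q\<close> modulo \<open>q V W(S)\<close>, and as \<open>F\<close> lifts Frobenius on \<open>T\<close>, say \<open>A\<^sub>0\<^sup>p = F(A\<^sub>0) + p d\<close>, one gets
  \<open>A\<^sub>0\<^sup>q \<equiv> F(b) + q A\<^sub>0\<^sup>q\<^sup>-\<^sup>p d\<close> modulo \<open>q p\<close>. Because \<open>T \<inter> V W(S) = p T\<close> (\<open>k\<close> is perfect), the difference
  can be divided by \<open>q\<close> inside \<open>F(T)\<close>, so \<open>\<Delta>\<^sub>n(a) \<equiv> a\<^sup>q\<^sup>-\<^sup>p d\<^sub>0\<close> modulo \<open>F(S)\<close> with \<open>d\<^sub>0\<close> independent of \<open>n\<close>;
  the case \<open>n = 1\<close> identifies \<open>d\<^sub>0\<close>.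
\<close>

section \<open>Evaluation of integer polynomials\<close>


text \<open>Evaluation, the Frobenius lift, p-th powers in characteristic p, constant terms and
  \<open>frob\<close> are all instances. Commuting with \<open>mpoly_eval\<close> makes the Witt
  operations functorial in each case.\<close>

locale unital_ring_hom =
  fixes h :: "'a::comm_ring_1 \<Rightarrow> 'b::comm_ring_1"
  assumes hom_add: "h (x + y) = h x + h y"
    and hom_mult: "h (x * y) = h x * h y"
    and hom_one [simp]: "h 1 = 1"
begin

lemma hom_zero [simp]: "h 0 = 0"
  using hom_add[of 0 0] by simp

lemma hom_uminus: "h (- x) = - h x"
  using hom_add[of x "- x"] by (simp add: eq_neg_iff_add_eq_0 add.commute)

lemma hom_diff: "h (x - y) = h x - h y"
  using hom_add[of x "- y"] by (simp add: hom_uminus)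

lemma hom_power: "h (x ^ n) = h x ^ n"
  by (induction n) (simp_all add: hom_mult)

lemma hom_sum: "h (sum f A) = (\<Sum>i\<in>A. h (f i))"
  by (induction A rule: infinite_finite_induct) (simp_all add: hom_add)

lemma hom_prod: "h (prod f A) = (\<Prod>i\<in>A. h (f i))"
  by (induction A rule: infinite_finite_induct) (simp_all add: hom_mult)

lemma hom_of_nat [simp]: "h (of_nat n) = of_nat n"
  by (induction n) (simp_all add: hom_add)

lemma hom_of_int [simp]: "h (of_int n) = of_int n"
  by (cases n) (simp_all add: hom_diff hom_uminus)

lemma hom_mpoly_eval: "h (mpoly_eval x f) = mpoly_eval (\<lambda>v. h (x v)) f"
  by (simp add: mpoly_eval_def hom_sum hom_mult hom_prod hom_power)

lemma hom_ghost: "h (ghost p n x) = ghost p n (\<lambda>i. h (x i))"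
  by (simp add: ghost_def hom_sum hom_mult hom_power del: of_nat_power)

end

lemma sum_single_lookup: "(\<Sum>m\<in>Poly_Mapping.keys f. Poly_Mapping.single m (Poly_Mapping.lookup f m)) = f"
  by (rule poly_mapping_eqI)
     (simp add: lookup_sum lookup_single when_def sum.delta in_keys_iff)

lemma prod_keys_superset:
  assumes "finite A" "Poly_Mapping.keys m \<subseteq> A"
  shows "(\<Prod>v\<in>Poly_Mapping.keys m. x v ^ Poly_Mapping.lookup m v) =
         (\<Prod>v\<in>A. (x v :: 'a::comm_semiring_1) ^ Poly_Mapping.lookup m v)"
  using assms by (intro prod.mono_neutral_left) (auto simp: in_keys_iff)

lemma prod_keys_add:
  "(\<Prod>v\<in>Poly_Mapping.keys (m + n). (x v :: 'a::comm_semiring_1) ^ Poly_Mapping.lookup (m + n) v) =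
   (\<Prod>v\<in>Poly_Mapping.keys m. x v ^ Poly_Mapping.lookup m v) *
   (\<Prod>v\<in>Poly_Mapping.keys n. x v ^ Poly_Mapping.lookup n v)"
proof -
  let ?A = "Poly_Mapping.keys m \<union> Poly_Mapping.keys n"
  have "(\<Prod>v\<in>Poly_Mapping.keys (m + n). x v ^ Poly_Mapping.lookup (m + n) v) =
      (\<Prod>v\<in>?A. x v ^ Poly_Mapping.lookup (m + n) v)"
    by (intro prod_keys_superset) (simp_all add: keys_add)
  then show ?thesis
    by (simp add: prod_keys_superset[of ?A m] prod_keys_superset[of ?A n]
        lookup_add power_add prod.distrib)
qed

lemma mpoly_eval_superset:
  assumes "finite A" "Poly_Mapping.keys f \<subseteq> A"
  shows "mpoly_eval x f = (\<Sum>m\<in>A. of_int (Poly_Mapping.lookup f m) *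
           (\<Prod>v\<in>Poly_Mapping.keys m. x v ^ Poly_Mapping.lookup m v))"
  unfolding mpoly_eval_def using assms by (intro sum.mono_neutral_left) (auto simp: in_keys_iff)

lemma mpoly_eval_add: "mpoly_eval x (f + g) = mpoly_eval x f + mpoly_eval x g"
proof -
  let ?A = "Poly_Mapping.keys f \<union> Poly_Mapping.keys g"
  have "Poly_Mapping.keys (f + g) \<subseteq> ?A" by (rule keys_add)
  then show ?thesis
    by (simp add: mpoly_eval_superset[of ?A "f + g"] mpoly_eval_superset[of ?A f] mpoly_eval_superset[of ?A g]
        lookup_add distrib_right sum.distrib)
qed

lemma mpoly_eval_zero: "mpoly_eval x 0 = 0"
  by (simp add: mpoly_eval_def)

lemma mpoly_eval_sum: "mpoly_eval x (sum f A) = (\<Sum>i\<in>A. mpoly_eval x (f i))"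
  by (induction A rule: infinite_finite_induct) (simp_all add: mpoly_eval_add mpoly_eval_zero)

lemma mpoly_eval_single:
  "mpoly_eval x (Poly_Mapping.single m c) =
     of_int c * (\<Prod>v\<in>Poly_Mapping.keys m. x v ^ Poly_Mapping.lookup m v)"
  by (simp add: mpoly_eval_def)

lemma mpoly_eval_mult: "mpoly_eval x (f * g) = mpoly_eval x f * mpoly_eval x g"
proof -
  let ?s = "\<lambda>f m. Poly_Mapping.single m (Poly_Mapping.lookup f m) :: ('b, int) mpoly"
  have *: "mpoly_eval x (?s f m * ?s g n) = mpoly_eval x (?s f m) * mpoly_eval x (?s g n)" for m n
    by (simp only: mult_single mpoly_eval_single prod_keys_add of_int_mult mult_ac)
  have "f * g = (\<Sum>m\<in>Poly_Mapping.keys f. \<Sum>n\<in>Poly_Mapping.keys g. ?s f m * ?s g n)"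
    by (simp only: sum_single_lookup flip: sum_product)
  then have "mpoly_eval x (f * g) =
      mpoly_eval x (\<Sum>m\<in>Poly_Mapping.keys f. ?s f m) * mpoly_eval x (\<Sum>n\<in>Poly_Mapping.keys g. ?s g n)"
    by (simp only: mpoly_eval_sum * sum_product)
  then show ?thesis by (simp only: sum_single_lookup)
qed

lemma mpoly_eval_one: "mpoly_eval x 1 = 1"
  using mpoly_eval_single[of x 0 1] by simp

interpretation mpoly_eval: unital_ring_hom "mpoly_eval x"
  by unfold_locales (simp_all add: mpoly_eval_add mpoly_eval_mult mpoly_eval_one)

lemma mpoly_eval_var [simp]: "mpoly_eval x (mpoly_var v) = x v"
  by (simp add: mpoly_var_def mpoly_eval_single)

lemma power_mpoly_var:
  "(mpoly_var v :: ('v, 'c::comm_ring_1) mpoly) ^ n = Poly_Mapping.single (Poly_Mapping.single v n) 1"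
  by (induction n) (simp_all add: mpoly_var_def mult_single single_add[symmetric])

lemma prod_single_one:
  "(\<Prod>i\<in>A. Poly_Mapping.single (e i) (1::'c::comm_semiring_1)) = Poly_Mapping.single (\<Sum>i\<in>A. e i) 1"
  by (induction A rule: infinite_finite_induct) (simp_all add: mult_single)

text \<open>Displays an integer polynomial as a sum of products of integers and variables, so that a
  property stable under ring operations need only be checked on those.\<close>

lemma mpoly_eval_mpoly_var: "mpoly_eval mpoly_var f = f"
proof -
  have "of_int c * Poly_Mapping.single m 1 = Poly_Mapping.single m c" for c :: int and m :: "'a \<Rightarrow>\<^sub>0 nat"
    using mult_single[of 0 c m 1] by (metis add_0 mult.right_neutral of_int_eq_id id_apply single_of_int)
  then have "mpoly_eval mpoly_var f = (\<Sum>m\<in>Poly_Mapping.keys f. Poly_Mapping.single m (Poly_Mapping.lookup f m))"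
    by (simp add: mpoly_eval_def power_mpoly_var prod_single_one sum_single_lookup)
  then show ?thesis by (simp only: sum_single_lookup)
qed

definition frob_lift :: "nat \<Rightarrow> ('v, int) mpoly \<Rightarrow> ('v, int) mpoly" where
  "frob_lift p = mpoly_eval (\<lambda>v. mpoly_var v ^ p)"

interpretation frob_lift: unital_ring_hom "frob_lift p"
  unfolding frob_lift_def by (rule mpoly_eval.unital_ring_hom_axioms)

lemma of_nat_dvd_power_diff:
  fixes x y :: "'a::comm_ring_1"
  assumes "of_nat m dvd x - y"
  shows "of_nat m dvd x ^ n - y ^ n"
  using assms by (metis dvd_mult2 power_diff_sumr2)


section \<open>Ghost components and Witt polynomials\<close>

lemma lookup_of_nat_mult: "Poly_Mapping.lookup (of_nat n * f) m = of_nat n * Poly_Mapping.lookup (f :: ('v, 'c::comm_ring_1) mpoly) m"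
  by (induction n) (simp_all add: distrib_right lookup_add)

lemma of_nat_mult_cancel_mpoly:
  fixes f g :: "('v, int) mpoly"
  assumes "n > 0" "of_nat n * f = of_nat n * g"
  shows "f = g"
proof (rule poly_mapping_eqI)
  fix m
  have "of_nat n * Poly_Mapping.lookup f m = of_nat n * Poly_Mapping.lookup g m"
    using arg_cong[OF assms(2), of "\<lambda>h. Poly_Mapping.lookup h m"] by (simp only: lookup_of_nat_mult)
  then show "Poly_Mapping.lookup f m = Poly_Mapping.lookup g m"
    using assms(1) by simp
qed

lemma of_nat_mult_dvd_cancel_mpoly:
  fixes f g :: "('v, int) mpoly"
  assumes "n > 0" "of_nat n * f dvd of_nat n * g"
  shows "f dvd g"
proof -
  obtain q where "of_nat n * g = of_nat n * f * q" using assms(2) by (rule dvdE)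
  then have "of_nat n * g = of_nat n * (f * q)" by (simp only: mult.assoc)
  then have "g = f * q" by (rule of_nat_mult_cancel_mpoly[OF assms(1)])
  then show ?thesis by (rule dvdI)
qed

lemma prime_dvd_freshman:
  fixes x y :: "'a::comm_ring_1"
  assumes "prime p"
  shows "of_nat p dvd (x + y) ^ p - (x ^ p + y ^ p)"
proof -
  let ?f = "\<lambda>k. of_nat (p choose k) * x ^ k * y ^ (p - k)"
  have p: "p > 0" using assms by (rule prime_gt_0_nat)
  have "(\<Sum>k\<le>p. ?f k) = (\<Sum>k\<in>{..p} - {0,p}. ?f k) + (\<Sum>k\<in>{0,p}. ?f k)"
    by (rule sum.subset_diff) auto
  also have "(\<Sum>k\<in>{0,p}. ?f k) = x ^ p + y ^ p"
    using p by (simp add: add.commute)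
  finally have "(x + y) ^ p - (x ^ p + y ^ p) = (\<Sum>k\<in>{..p} - {0,p}. ?f k)"
    by (simp only: binomial_ring[of x y p] add_diff_cancel_right')
  moreover have "of_nat p dvd (\<Sum>k\<in>{..p} - {0,p}. ?f k)"
  proof (rule dvd_sum)
    fix k assume "k \<in> {..p} - {0,p}"
    then have "p dvd p choose k" using assms by (intro dvd_choose_prime) auto
    then show "of_nat p dvd ?f k"
      by (intro dvd_mult2) (auto simp: dvd_def)
  qed
  ultimately show ?thesis by (simp only:)
qed

text \<open>Modulo p, taking p-th powers is additive and multiplicative, as is
  \<open>frob_lift p\<close>, and both agree on integers and variables; hence they agree
  everywhere.\<close>

lemma frob_lift_cong:
  assumes p: "prime p"
  shows "of_nat p dvd f ^ p - frob_lift p f"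
proof -
  have p0: "p > 0" using p by (rule prime_gt_0_nat)
  define Q where "Q f \<longleftrightarrow> of_nat p dvd f ^ p - frob_lift p f" for f :: "('a, int) mpoly"
  have add: "Q (f + g)" if "Q f" "Q g" for f g
  proof -
    have "(f + g) ^ p - frob_lift p (f + g) =
        ((f + g) ^ p - (f ^ p + g ^ p)) + ((f ^ p - frob_lift p f) + (g ^ p - frob_lift p g))"
      by (simp add: frob_lift.hom_add)
    then show ?thesis
      using that prime_dvd_freshman[OF p, of f g] unfolding Q_def by (simp only: dvd_add)
  qed
  have mult: "Q (f * g)" if "Q f" "Q g" for f g
  proof -
    have "(f * g) ^ p - frob_lift p (f * g) =
        (f ^ p - frob_lift p f) * g ^ p + frob_lift p f * (g ^ p - frob_lift p g)"
      by (simp add: frob_lift.hom_mult power_mult_distrib algebra_simps)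
    then show ?thesis
      using that unfolding Q_def by (simp only: dvd_add dvd_mult dvd_mult2)
  qed
  have "(0 :: ('a, int) mpoly) ^ p = 0" using p0 by (rule zero_power)
  then have Q0: "Q 0" by (simp add: Q_def)
  have Q1: "Q 1" by (simp add: Q_def)
  have Qnat: "Q (of_nat n)" for n by (induction n) (simp_all add: Q0 Q1 add)
  \<comment> \<open>Applying the binomial congruence to f and -f, whose sum is 0, avoids the sign
    (-1)^p and treats p = 2 alike.\<close>
  have uminus: "Q (- f)" if "Q f" for f
  proof -
    have "(- f) ^ p - frob_lift p (- f) = - ((f + - f) ^ p - (f ^ p + (- f) ^ p)) - (f ^ p - frob_lift p f)"
      using p0 by (simp add: frob_lift.hom_uminus zero_power)
    then show ?thesis
      using that prime_dvd_freshman[OF p, of f "- f"] unfolding Q_def by (simp only: dvd_diff dvd_minus_iff)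
  qed
  have Qint: "Q (of_int c)" for c
    using add[OF Qnat uminus[OF Qnat]] by (cases c rule: int_diff_cases) simp
  have Qvar: "Q (mpoly_var v)" for v by (simp add: Q_def frob_lift_def)
  have Qpow: "Q (f ^ n)" if "Q f" for f n
    by (induction n) (auto intro: mult Q1 that)
  have Qprod: "Q (\<Prod>i\<in>A. g i)" if "\<And>i. Q (g i)" for A :: "'b set" and g
    by (induction A rule: infinite_finite_induct) (auto intro: mult Q1 that)
  have Qsum: "Q (\<Sum>i\<in>A. g i)" if "\<And>i. Q (g i)" for A :: "'b set" and g
    by (induction A rule: infinite_finite_induct) (auto intro: add Q0 that)
  have "Q (mpoly_eval mpoly_var f)"
    unfolding mpoly_eval_def by (intro Qsum mult Qint Qprod Qpow Qvar)
  then show ?thesis by (simp add: mpoly_eval_mpoly_var Q_def)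
qed

text \<open>Divide x^p - y^p by x - y: modulo p every x^i in the quotient may be replaced by y^i,
  which leaves p y^(p-1). So each p-th power gains a factor p.\<close>

lemma of_nat_power_dvd_diff_power:
  fixes x y :: "'a::comm_ring_1"
  assumes "of_nat (p ^ Suc k) dvd x - y"
  shows "of_nat (p ^ Suc (Suc k)) dvd x ^ p - y ^ p"
proof -
  have "of_nat p dvd x - y"
    using assms by (simp add: dvd_mult_left)
  then have "of_nat p dvd (x ^ i - y ^ i) * y ^ j" for i j
    by (intro dvd_mult2 of_nat_dvd_power_diff)
  then have "of_nat p dvd (\<Sum>i<p. (x ^ i - y ^ i) * y ^ (p - Suc i)) + of_nat p * y ^ (p - 1)"
    by (intro dvd_add dvd_sum) auto
  moreover have "(\<Sum>i<p. (x ^ i - y ^ i) * y ^ (p - Suc i)) + of_nat p * y ^ (p - 1) =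
      (\<Sum>i<p. y ^ (p - Suc i) * x ^ i)"
  proof -
    have "(\<Sum>i<p. y ^ i * y ^ (p - Suc i)) = (\<Sum>i<p. y ^ (p - 1))"
      by (intro sum.cong refl) (auto simp: power_add[symmetric])
    then show ?thesis
      by (simp add: left_diff_distrib sum_subtractf, simp add: mult.commute)
  qed
  ultimately have "of_nat p dvd (\<Sum>i<p. y ^ (p - Suc i) * x ^ i)"
    by simp
  then have "of_nat (p ^ Suc k) * of_nat p dvd (x - y) * (\<Sum>i<p. y ^ (p - Suc i) * x ^ i)"
    using assms by (rule mult_dvd_mono[rotated])
  moreover have "of_nat (p ^ Suc k) * of_nat p = (of_nat (p ^ Suc (Suc k)) :: 'a)"
    by (simp only: of_nat_mult[symmetric] power_Suc mult_ac)
  ultimately show ?thesis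
    by (simp only: power_diff_sumr2)
qed

lemma of_nat_power_dvd_diff_power_power:
  fixes x y :: "'a::comm_ring_1"
  assumes "of_nat p dvd x - y"
  shows "of_nat (p ^ Suc k) dvd x ^ (p ^ k) - y ^ (p ^ k)"
proof (induction k)
  case (Suc k)
  then have "of_nat (p ^ Suc (Suc k)) dvd (x ^ p ^ k) ^ p - (y ^ p ^ k) ^ p"
    by (rule of_nat_power_dvd_diff_power)
  moreover have "(z ^ p ^ k) ^ p = z ^ p ^ Suc k" for z :: 'a
    by (simp only: power_mult[symmetric] power_Suc2)
  ultimately show ?case by (simp only:)
qed (use assms in auto)

lemma ghost_0 [simp]: "ghost p 0 x = x 0"
  by (simp add: ghost_def)

text \<open>The recursion behind Dwork's criterion: below the top term, the next ghost component is
  the previous one taken at p-th powers, which modulo p are Frobenius lifts for integer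
  polynomials.\<close>

lemma ghost_Suc:
  "ghost p (Suc n) x = ghost p n (\<lambda>i. x i ^ p) + of_nat (p ^ Suc n) * x (Suc n)"
proof -
  have "(x i ^ p) ^ p ^ (n - i) = x i ^ p ^ (Suc n - i)" if "i \<le> n" for i
    using that by (simp only: power_mult[symmetric] Suc_diff_le power_Suc)
  then have "(\<Sum>i\<le>n. of_nat (p ^ i) * (x i ^ p) ^ p ^ (n - i)) =
      (\<Sum>i\<le>n. of_nat (p ^ i) * x i ^ p ^ (Suc n - i))"
    by (intro sum.cong) simp_all
  then show ?thesis
    unfolding ghost_def by (simp only: sum.atMost_Suc diff_self_eq_0 power_0 power_one_right)
qed

lemma ghost_split: "ghost p n x = (\<Sum>i<n. of_nat (p ^ i) * x i ^ (p ^ (n - i))) + of_nat (p ^ n) * x n"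
  by (simp only: ghost_def lessThan_Suc_atMost[symmetric] sum.lessThan_Suc diff_self_eq_0 power_0 power_one_right)

definition vseq :: "(nat \<Rightarrow> 'a::zero) \<Rightarrow> nat \<Rightarrow> 'a" where
  "vseq x n = (case n of 0 \<Rightarrow> 0 | Suc i \<Rightarrow> x i)"

lemma vseq_simps [simp]: "vseq x 0 = 0" "vseq x (Suc i) = x i"
  by (simp_all add: vseq_def)

lemma ghost_verschiebung:
  assumes "p > 0"
  shows "ghost p n (vseq x) = (case n of 0 \<Rightarrow> 0 | Suc k \<Rightarrow> of_nat p * ghost p k x)"
proof (cases n)
  case (Suc k)
  have "ghost p (Suc k) (vseq x) = (\<Sum>i\<le>k. of_nat (p ^ Suc i) * x i ^ p ^ (k - i))"
    unfolding ghost_def using assms by (subst sum.atMost_Suc_shift) (simp add: power_0_left)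
  then show ?thesis
    using Suc by (simp add: ghost_def sum_distrib_left mult.assoc)
qed (simp add: ghost_def)

text \<open>The term of index i carries p^i, and raising to the power p^(n-i) turns a congruence
  modulo p into one modulo p^(n-i+1).\<close>

lemma ghost_cong:
  assumes "\<And>i. i \<le> n \<Longrightarrow> of_nat p dvd x i - y i"
  shows "of_nat (p ^ Suc n) dvd ghost p n x - ghost p n y"
proof -
  have "of_nat (p ^ Suc n) dvd of_nat (p ^ i) * (x i ^ p ^ (n - i) - y i ^ p ^ (n - i))" if "i \<le> n" for i
  proof -
    have "of_nat (p ^ i) * of_nat (p ^ Suc (n - i)) dvd of_nat (p ^ i) * (x i ^ p ^ (n - i) - y i ^ p ^ (n - i))"
      using assms[OF that] by (intro mult_dvd_mono of_nat_power_dvd_diff_power_power) auto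
    moreover have "(of_nat (p ^ Suc n) :: 'a) = of_nat (p ^ i) * of_nat (p ^ Suc (n - i))"
      using that by (simp only: of_nat_mult[symmetric] power_add[symmetric]) simp
    ultimately show ?thesis by simp
  qed
  then have "of_nat (p ^ Suc n) dvd (\<Sum>i\<le>n. of_nat (p ^ i) * (x i ^ p ^ (n - i) - y i ^ p ^ (n - i)))"
    by (intro dvd_sum) auto
  then show ?thesis
    by (simp only: ghost_def right_diff_distrib sum_subtractf)
qed

text \<open>For the converse, strong induction removes the terms below n and leaves p^n (x_n - y_n),
  where p^n cancels because integer polynomials are torsion free.\<close>

lemma ghost_cong_iff:
  fixes x y :: "nat \<Rightarrow> ('v, int) mpoly"
  assumes "p > 0"
  shows "(\<forall>n. of_nat (p ^ Suc n) dvd ghost p n x - ghost p n y) \<longleftrightarrow> (\<forall>i. of_nat p dvd x i - y i)"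
proof (intro iffI allI)
  fix i assume H: "\<forall>n. of_nat (p ^ Suc n) dvd ghost p n x - ghost p n y"
  show "of_nat p dvd x i - y i"
  proof (induction i rule: less_induct)
    case (less n)
    show ?case
    proof (cases n)
      case 0
      then show ?thesis using H[rule_format, of 0] by simp
    next
      case (Suc k)
      have "of_nat (p ^ Suc n) dvd of_nat (p ^ n) * (x n - y n)"
      proof -
        have "of_nat (p ^ Suc n) dvd of_nat (p ^ i) * (x i ^ p ^ (n - i) - y i ^ p ^ (n - i))" if "i < n" for i
        proof -
          have "of_nat (p ^ i) * of_nat (p ^ Suc (n - i)) dvd of_nat (p ^ i) * (x i ^ p ^ (n - i) - y i ^ p ^ (n - i))"
            using less[OF that] by (intro mult_dvd_mono of_nat_power_dvd_diff_power_power) auto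
          moreover have "(of_nat (p ^ Suc n) :: ('v, int) mpoly) = of_nat (p ^ i) * of_nat (p ^ Suc (n - i))"
            using that by (simp only: of_nat_mult[symmetric] power_add[symmetric]) simp
          ultimately show ?thesis by simp
        qed
        then have "of_nat (p ^ Suc n) dvd (\<Sum>i<n. of_nat (p ^ i) * (x i ^ p ^ (n - i) - y i ^ p ^ (n - i)))"
          by (intro dvd_sum) auto
        then have "of_nat (p ^ Suc n) dvd ghost p n x - ghost p n y -
            (\<Sum>i<n. of_nat (p ^ i) * (x i ^ p ^ (n - i) - y i ^ p ^ (n - i)))"
          using H[rule_format, of n] by (rule dvd_diff[rotated])
        moreover have "ghost p n x - ghost p n y -
            (\<Sum>i<n. of_nat (p ^ i) * (x i ^ p ^ (n - i) - y i ^ p ^ (n - i))) =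
            of_nat (p ^ n) * (x n - y n)"
          by (simp only: ghost_split right_diff_distrib sum_subtractf) (simp only: algebra_simps)
        ultimately show ?thesis by (simp only:)
      qed
      then have "of_nat (p ^ n) * of_nat p dvd of_nat (p ^ n) * (x n - y n)"
        by (simp only: power_Suc of_nat_mult mult.commute)
      moreover have "p ^ n > 0" using assms by simp
      ultimately show ?thesis
        by (rule of_nat_mult_dvd_cancel_mpoly[rotated])
    qed
  qed
qed (rule ghost_cong, blast)

text \<open>The ghost equations are triangular with leading coefficients p^n, which cancel.\<close>

lemma ghost_inj:
  fixes x y :: "nat \<Rightarrow> ('v, int) mpoly"
  assumes "p > 0" "\<And>n. ghost p n x = ghost p n y"
  shows "x = y"
proof
  fix n show "x n = y n"
  proof (induction n rule: less_induct)
    case (less n)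
    then have "(\<Sum>i<n. of_nat (p ^ i) * x i ^ p ^ (n - i)) = (\<Sum>i<n. of_nat (p ^ i) * y i ^ p ^ (n - i))"
      by (intro sum.cong) auto
    then have "of_nat (p ^ n) * x n = of_nat (p ^ n) * y n"
      using assms(2)[of n] by (simp add: ghost_split del: of_nat_power)
    moreover have "p ^ n > 0" using assms(1) by simp
    ultimately show ?case
      by (rule of_nat_mult_cancel_mpoly[rotated])
  qed
qed

section \<open>Dwork's criterion and the existence of the Witt polynomials\<close>

definition dwork :: "nat \<Rightarrow> (nat \<Rightarrow> ('v, int) mpoly) \<Rightarrow> bool" where
  "dwork p w \<longleftrightarrow> (\<forall>n. of_nat (p ^ Suc n) dvd w (Suc n) - frob_lift p (w n))"

text \<open>The lift commutes with \<open>ghost\<close>, so only \<open>frob_lift p (x i)\<close>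
  and x_i^p need comparing, and these agree modulo p.\<close>

lemma dwork_step:
  assumes "prime p"
  shows "of_nat (p ^ Suc n) dvd ghost p n (\<lambda>i. x i ^ p) - frob_lift p (ghost p n x)"
  unfolding frob_lift.hom_ghost by (intro ghost_cong frob_lift_cong assms)

lemma dwork_ghost:
  assumes "prime p"
  shows "dwork p (\<lambda>n. ghost p n x)"
  unfolding dwork_def
proof
  fix n
  have "ghost p (Suc n) x - frob_lift p (ghost p n x) =
      (ghost p n (\<lambda>i. x i ^ p) - frob_lift p (ghost p n x)) + of_nat (p ^ Suc n) * x (Suc n)"
    by (simp only: ghost_Suc) simp
  then show "of_nat (p ^ Suc n) dvd ghost p (Suc n) x - frob_lift p (ghost p n x)"
    using dwork_step[OF assms, of n x] by (simp only: dvd_add dvd_triv_left)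
qed

lemma dwork_add:
  assumes "dwork p v" "dwork p w"
  shows "dwork p (\<lambda>n. v n + w n)"
  unfolding dwork_def
proof
  fix n
  have "v (Suc n) + w (Suc n) - frob_lift p (v n + w n) =
      (v (Suc n) - frob_lift p (v n)) + (w (Suc n) - frob_lift p (w n))"
    by (simp add: frob_lift.hom_add)
  then show "of_nat (p ^ Suc n) dvd v (Suc n) + w (Suc n) - frob_lift p (v n + w n)"
    using assms by (simp only: dwork_def dvd_add)
qed

lemma dwork_uminus:
  assumes "dwork p v"
  shows "dwork p (\<lambda>n. - v n)"
  unfolding dwork_def
proof
  fix n
  have "- v (Suc n) - frob_lift p (- v n) = - (v (Suc n) - frob_lift p (v n))"
    by (simp add: frob_lift.hom_uminus)
  then show "of_nat (p ^ Suc n) dvd - v (Suc n) - frob_lift p (- v n)"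
    using assms by (simp only: dwork_def dvd_minus_iff)
qed

lemma dwork_mult:
  assumes "dwork p v" "dwork p w"
  shows "dwork p (\<lambda>n. v n * w n)"
  unfolding dwork_def
proof
  fix n
  let ?q = "of_nat (p ^ Suc n) :: ('a, int) mpoly"
  have "v (Suc n) * w (Suc n) - frob_lift p (v n * w n) =
      (v (Suc n) - frob_lift p (v n)) * w (Suc n) + frob_lift p (v n) * (w (Suc n) - frob_lift p (w n))"
    by (simp add: frob_lift.hom_mult algebra_simps)
  moreover have "?q dvd v (Suc n) - frob_lift p (v n)" "?q dvd w (Suc n) - frob_lift p (w n)"
    using assms by (simp_all only: dwork_def)
  ultimately show "?q dvd v (Suc n) * w (Suc n) - frob_lift p (v n * w n)"
    by (simp only: dvd_add dvd_mult dvd_mult2)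
qed

text \<open>Solves the ghost equations one component at a time. The choice is a true quotient when
  the division is possible, which \<open>dwork\<close> guarantees.\<close>

fun unghost :: "nat \<Rightarrow> (nat \<Rightarrow> ('v, int) mpoly) \<Rightarrow> nat \<Rightarrow> ('v, int) mpoly" where
  "unghost p w n = (SOME q. of_nat (p ^ n) * q =
     w n - (\<Sum>i\<in>{..<n}. of_nat (p ^ i) * unghost p w i ^ (p ^ (n - i))))"

declare unghost.simps [simp del]

lemma ghost_unghost:
  assumes p: "prime p" and w: "dwork p w"
  shows "ghost p n (unghost p w) = w n"
proof (induction n)
  case 0
  have "(SOME q. q = w 0) = w 0" by (rule someI) (rule refl)
  then show ?case by (simp add: unghost.simps[of p w 0])
next
  case (Suc n)
  let ?u = "unghost p w" and ?q = "of_nat (p ^ Suc n) :: ('a, int) mpoly"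
  let ?r = "\<Sum>i<Suc n. of_nat (p ^ i) * ?u i ^ (p ^ (Suc n - i))"
  \<comment> \<open>The lower terms are a ghost component at p-th powers, hence congruent modulo
    p^(n+1) to the lift of \<open>w n\<close>. Dwork's condition says the same of
    \<open>w (Suc n)\<close>, so p^(n+1) divides the difference.\<close>
  have "?r = ghost p n (\<lambda>i. ?u i ^ p)"
    using ghost_Suc[of p n ?u] by (simp add: ghost_split[of p "Suc n"] del: of_nat_power sum.lessThan_Suc)
  moreover have "?q dvd ghost p n (\<lambda>i. ?u i ^ p) - frob_lift p (w n)"
    using dwork_step[OF p, of n ?u] Suc by simp
  moreover have "?q dvd w (Suc n) - frob_lift p (w n)"
    using w by (simp only: dwork_def)
  ultimately have "?q dvd (w (Suc n) - frob_lift p (w n)) - (?r - frob_lift p (w n))"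
    by (simp only: dvd_diff)
  then have "?q dvd w (Suc n) - ?r"
    by (simp only: diff_diff_eq2 diff_add_cancel)
  then obtain q where "w (Suc n) - ?r = ?q * q" by (rule dvdE)
  then have "\<exists>q. ?q * q = w (Suc n) - ?r" by (metis (no_types))
  then have "?q * ?u (Suc n) = w (Suc n) - ?r"
    by (subst unghost.simps) (rule someI_ex)
  then show ?case by (simp add: ghost_split[of p "Suc n"] del: of_nat_power sum.lessThan_Suc)
qed

text \<open>Gives meaning to the definite descriptions of the Witt polynomials, since Dwork's
  condition is stable under ring operations.\<close>

lemma ex1_ghost:
  assumes "prime p" "dwork p w"
  shows "\<exists>!u. \<forall>n. ghost p n u = w n"
proof (rule ex1I[of _ "unghost p w"])
  show "\<forall>n. ghost p n (unghost p w) = w n" using ghost_unghost[OF assms] by blast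
  fix u assume "\<forall>n. ghost p n u = w n"
  then show "u = unghost p w"
    using assms by (intro ghost_inj[of p]) (auto simp: ghost_unghost prime_gt_0_nat)
qed

text \<open>Negation needs universal polynomials of its own: for p = 2 it is not
  componentwise.\<close>

definition witt_uminus_poly :: "nat \<Rightarrow> nat \<Rightarrow> (nat, int) mpoly" where
  "witt_uminus_poly p = (THE \<phi>. \<forall>n. ghost p n \<phi> = - ghost p n mpoly_var)"

lemma ghost_witt_add_poly:
  assumes "prime p"
  shows "ghost p n (witt_add_poly p) =
     ghost p n (\<lambda>i. mpoly_var (Inl i)) + ghost p n (\<lambda>i. mpoly_var (Inr i))"
  using theI'[OF ex1_ghost[OF assms dwork_add[OF dwork_ghost dwork_ghost, OF assms assms]]]
  unfolding witt_add_poly_def by blast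

lemma ghost_witt_mult_poly:
  assumes "prime p"
  shows "ghost p n (witt_mult_poly p) =
     ghost p n (\<lambda>i. mpoly_var (Inl i)) * ghost p n (\<lambda>i. mpoly_var (Inr i))"
  using theI'[OF ex1_ghost[OF assms dwork_mult[OF dwork_ghost dwork_ghost, OF assms assms]]]
  unfolding witt_mult_poly_def by blast

lemma ghost_witt_uminus_poly:
  assumes "prime p"
  shows "ghost p n (witt_uminus_poly p) = - ghost p n mpoly_var"
  using theI'[OF ex1_ghost[OF assms dwork_uminus[OF dwork_ghost, OF assms]]]
  unfolding witt_uminus_poly_def by blast

section \<open>Witt operations on sequences and their ghost components\<close>

definition witt_add :: "nat \<Rightarrow> (nat \<Rightarrow> 'a::comm_ring_1) \<Rightarrow> (nat \<Rightarrow> 'a) \<Rightarrow> nat \<Rightarrow> 'a" where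
  "witt_add p x y n = mpoly_eval (case_sum x y) (witt_add_poly p n)"

definition witt_mult :: "nat \<Rightarrow> (nat \<Rightarrow> 'a::comm_ring_1) \<Rightarrow> (nat \<Rightarrow> 'a) \<Rightarrow> nat \<Rightarrow> 'a" where
  "witt_mult p x y n = mpoly_eval (case_sum x y) (witt_mult_poly p n)"

definition witt_uminus :: "nat \<Rightarrow> (nat \<Rightarrow> 'a::comm_ring_1) \<Rightarrow> nat \<Rightarrow> 'a" where
  "witt_uminus p x n = mpoly_eval x (witt_uminus_poly p n)"

lemma ghost_witt_add:
  assumes "prime p"
  shows "ghost p n (witt_add p x y) = ghost p n x + ghost p n y"
proof -
  have "ghost p n (witt_add p x y) = mpoly_eval (case_sum x y) (ghost p n (witt_add_poly p))"
    by (simp add: mpoly_eval.hom_ghost witt_add_def[abs_def])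
  then show ?thesis
    by (simp add: ghost_witt_add_poly[OF assms] mpoly_eval.hom_add mpoly_eval.hom_ghost)
qed

lemma ghost_witt_mult:
  assumes "prime p"
  shows "ghost p n (witt_mult p x y) = ghost p n x * ghost p n y"
proof -
  have "ghost p n (witt_mult p x y) = mpoly_eval (case_sum x y) (ghost p n (witt_mult_poly p))"
    by (simp add: mpoly_eval.hom_ghost witt_mult_def[abs_def])
  then show ?thesis
    by (simp add: ghost_witt_mult_poly[OF assms] mpoly_eval.hom_mult mpoly_eval.hom_ghost)
qed

lemma ghost_witt_uminus:
  assumes "prime p"
  shows "ghost p n (witt_uminus p x) = - ghost p n x"
proof -
  have "ghost p n (witt_uminus p x) = mpoly_eval x (ghost p n (witt_uminus_poly p))"
    by (simp add: mpoly_eval.hom_ghost witt_uminus_def[abs_def])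
  then show ?thesis
    by (simp add: ghost_witt_uminus_poly[OF assms] mpoly_eval.hom_uminus mpoly_eval.hom_ghost)
qed

context unital_ring_hom
begin

lemma hom_witt_add: "h (witt_add p x y n) = witt_add p (\<lambda>i. h (x i)) (\<lambda>i. h (y i)) n"
proof -
  have "(\<lambda>v. h (case_sum x y v)) = case_sum (\<lambda>i. h (x i)) (\<lambda>i. h (y i))"
    by (auto split: sum.split)
  then show ?thesis by (simp add: witt_add_def hom_mpoly_eval)
qed

lemma hom_witt_mult: "h (witt_mult p x y n) = witt_mult p (\<lambda>i. h (x i)) (\<lambda>i. h (y i)) n"
proof -
  have "(\<lambda>v. h (case_sum x y v)) = case_sum (\<lambda>i. h (x i)) (\<lambda>i. h (y i))"
    by (auto split: sum.split)
  then show ?thesis by (simp add: witt_mult_def hom_mpoly_eval)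
qed

lemma hom_witt_uminus: "h (witt_uminus p x n) = witt_uminus p (\<lambda>i. h (x i)) n"
  by (simp add: witt_uminus_def hom_mpoly_eval)

lemma hom_vseq: "h (vseq x n) = vseq (\<lambda>i. h (x i)) n"
  by (simp add: vseq_def split: nat.split)

lemma hom_teichmueller: "h (teichmueller a n) = teichmueller (h a) n"
  by (simp add: teichmueller_def)

end

lemma ghost_teichmueller:
  assumes "p > 0"
  shows "ghost p n (teichmueller a) = a ^ (p ^ n)"
proof -
  have "ghost p n (teichmueller a) = (\<Sum>i\<le>n. if i = 0 then a ^ (p ^ n) else 0)"
    unfolding ghost_def teichmueller_def using assms
    by (intro sum.cong refl) (auto simp: power_0_left)
  then show ?thesis by simp
qed

lemma ghost_zero:
  assumes "p > 0"
  shows "ghost p n (\<lambda>_. 0) = 0"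
  using assms by (simp add: ghost_def power_0_left)


lemma ghost_add_shift:
  assumes "p > 0"
  shows "ghost p n (teichmueller (x 0)) + ghost p n (vseq (\<lambda>i. x (Suc i))) = ghost p n x"
proof (cases n)
  case (Suc k)
  have "ghost p (Suc k) x = x 0 ^ (p ^ Suc k) + (\<Sum>i\<le>k. of_nat (p ^ Suc i) * x (Suc i) ^ p ^ (k - i))"
    unfolding ghost_def by (subst sum.atMost_Suc_shift) simp
  then show ?thesis
    using Suc assms by (simp add: ghost_teichmueller ghost_verschiebung ghost_def[of p k] sum_distrib_left mult.assoc)
qed (use assms in \<open>simp_all add: ghost_verschiebung teichmueller_def\<close>)

text \<open>Multiples on bare sequences, so that identities such as VF = p can be stated before the
  ring type exists.\<close>

fun witt_nsmul :: "nat \<Rightarrow> nat \<Rightarrow> (nat \<Rightarrow> 'a::comm_ring_1) \<Rightarrow> nat \<Rightarrow> 'a" where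
  "witt_nsmul p 0 x = (\<lambda>_. 0)"
| "witt_nsmul p (Suc k) x = witt_add p x (witt_nsmul p k x)"

lemma ghost_witt_nsmul:
  assumes "prime p"
  shows "ghost p n (witt_nsmul p k x) = of_nat k * ghost p n x"
  using assms prime_gt_0_nat[OF assms]
  by (induction k) (simp_all add: ghost_witt_add ghost_zero algebra_simps)

lemma (in unital_ring_hom) hom_witt_nsmul: "h (witt_nsmul p k x n) = witt_nsmul p k (\<lambda>i. h (x i)) n"
  by (induction k arbitrary: n) (simp_all add: hom_witt_add)

text \<open>Every commutative ring is a quotient of a polynomial ring over the integers. There the ghost map is
  injective, so identities between Witt vectors are checked on generic ones and then specialized.\<close>

abbreviation generic :: "(nat \<Rightarrow> 'a) \<Rightarrow> nat \<Rightarrow> ('a, int) mpoly" where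
  "generic x \<equiv> \<lambda>i. mpoly_var (x i)"

text \<open>The variables are the ring elements themselves, so evaluating each at itself is the
  canonical surjection onto the ring.\<close>

abbreviation specialize :: "('a::comm_ring_1, int) mpoly \<Rightarrow> 'a" where
  "specialize \<equiv> mpoly_eval (\<lambda>v. v)"

lemma specialize_cong:
  assumes "CHAR('a::comm_ring_1) = p" "of_nat p dvd f - g"
  shows "specialize f = (specialize g :: 'a)"
proof -
  obtain q where "f - g = of_nat p * q" using assms(2) by (rule dvdE)
  then have "specialize f - specialize g = of_nat p * (specialize q :: 'a)"
    by (simp flip: mpoly_eval.hom_diff add: mpoly_eval.hom_mult)
  also have "of_nat p = (0 :: 'a)" using assms(1) of_nat_CHAR by blast
  finally show ?thesis by simp
qed

lemmas specialize_simps = mpoly_eval.hom_witt_add mpoly_eval.hom_witt_mult mpoly_eval.hom_witt_uminus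
  mpoly_eval.hom_witt_nsmul mpoly_eval.hom_teichmueller mpoly_eval.hom_vseq

lemmas ghost_simps = ghost_witt_add ghost_witt_mult ghost_witt_uminus ghost_witt_nsmul

section \<open>Ring axioms and the identities for V and F\<close>

lemma witt_add_assoc:
  assumes p: "prime p"
  shows "witt_add p (witt_add p x y) z = witt_add p x (witt_add p y z)"
proof
  fix n
  have "witt_add p (witt_add p (generic x) (generic y)) (generic z) = witt_add p (generic x) (witt_add p (generic y) (generic z))"
    using p by (intro ghost_inj[of p]) (simp_all add: ghost_simps prime_gt_0_nat add.assoc)
  then have "specialize (witt_add p (witt_add p (generic x) (generic y)) (generic z) n) =
      specialize (witt_add p (generic x) (witt_add p (generic y) (generic z)) n)" by (simp only:)
  then show "witt_add p (witt_add p x y) z n = witt_add p x (witt_add p y z) n"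
    by (simp add: specialize_simps)
qed

lemma witt_add_commute:
  assumes p: "prime p"
  shows "witt_add p x y = witt_add p y x"
proof
  fix n
  have "witt_add p (generic x) (generic y) = witt_add p (generic y) (generic x)"
    using p by (intro ghost_inj[of p]) (simp_all add: ghost_simps prime_gt_0_nat add.commute)
  then have "specialize (witt_add p (generic x) (generic y) n) = specialize (witt_add p (generic y) (generic x) n)" by (simp only:)
  then show "witt_add p x y n = witt_add p y x n"
    by (simp add: specialize_simps)
qed

lemma witt_add_zero:
  assumes p: "prime p"
  shows "witt_add p (\<lambda>_. 0) x = x"
proof
  fix n
  have "witt_add p (\<lambda>_. 0) (generic x) = generic x"
    using p by (intro ghost_inj[of p]) (simp_all add: ghost_simps ghost_zero prime_gt_0_nat)
  then have "specialize (witt_add p (\<lambda>_. 0) (generic x) n) = specialize (generic x n)" by (simp only:)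
  then show "witt_add p (\<lambda>_. 0) x n = x n"
    by (simp add: specialize_simps)
qed

lemma witt_add_uminus:
  assumes p: "prime p"
  shows "witt_add p (witt_uminus p x) x = (\<lambda>_. 0)"
proof
  fix n
  have "witt_add p (witt_uminus p (generic x)) (generic x) = (\<lambda>_. 0)"
    using p by (intro ghost_inj[of p]) (simp_all add: ghost_simps ghost_zero prime_gt_0_nat)
  then have "specialize (witt_add p (witt_uminus p (generic x)) (generic x) n) = specialize 0" by (simp only:)
  then show "witt_add p (witt_uminus p x) x n = 0"
    by (simp add: specialize_simps)
qed

lemma witt_mult_assoc:
  assumes p: "prime p"
  shows "witt_mult p (witt_mult p x y) z = witt_mult p x (witt_mult p y z)"
proof
  fix n
  have "witt_mult p (witt_mult p (generic x) (generic y)) (generic z) = witt_mult p (generic x) (witt_mult p (generic y) (generic z))"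
    using p by (intro ghost_inj[of p]) (simp_all add: ghost_simps prime_gt_0_nat mult.assoc)
  then have "specialize (witt_mult p (witt_mult p (generic x) (generic y)) (generic z) n) =
      specialize (witt_mult p (generic x) (witt_mult p (generic y) (generic z)) n)" by (simp only:)
  then show "witt_mult p (witt_mult p x y) z n = witt_mult p x (witt_mult p y z) n"
    by (simp add: specialize_simps)
qed

lemma witt_mult_commute:
  assumes p: "prime p"
  shows "witt_mult p x y = witt_mult p y x"
proof
  fix n
  have "witt_mult p (generic x) (generic y) = witt_mult p (generic y) (generic x)"
    using p by (intro ghost_inj[of p]) (simp_all add: ghost_simps prime_gt_0_nat mult.commute)
  then have "specialize (witt_mult p (generic x) (generic y) n) = specialize (witt_mult p (generic y) (generic x) n)" by (simp only:)
  then show "witt_mult p x y n = witt_mult p y x n"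
    by (simp add: specialize_simps)
qed

lemma witt_mult_one:
  assumes p: "prime p"
  shows "witt_mult p (teichmueller 1) x = x"
proof
  fix n
  have "witt_mult p (teichmueller 1) (generic x) = generic x"
    using p by (intro ghost_inj[of p]) (simp_all add: ghost_simps ghost_teichmueller prime_gt_0_nat)
  then have "specialize (witt_mult p (teichmueller 1) (generic x) n) = specialize (generic x n)" by (simp only:)
  then show "witt_mult p (teichmueller 1) x n = x n"
    by (simp add: specialize_simps)
qed

lemma witt_distrib:
  assumes p: "prime p"
  shows "witt_mult p (witt_add p x y) z = witt_add p (witt_mult p x z) (witt_mult p y z)"
proof
  fix n
  have "witt_mult p (witt_add p (generic x) (generic y)) (generic z) =
      witt_add p (witt_mult p (generic x) (generic z)) (witt_mult p (generic y) (generic z))"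
    using p by (intro ghost_inj[of p]) (simp_all add: ghost_simps prime_gt_0_nat distrib_right)
  then have "specialize (witt_mult p (witt_add p (generic x) (generic y)) (generic z) n) =
      specialize (witt_add p (witt_mult p (generic x) (generic z)) (witt_mult p (generic y) (generic z)) n)" by (simp only:)
  then show "witt_mult p (witt_add p x y) z n = witt_add p (witt_mult p x z) (witt_mult p y z) n"
    by (simp add: specialize_simps)
qed

lemma witt_mult_teichmueller:
  assumes p: "prime p"
  shows "witt_mult p (teichmueller a) (teichmueller b) = teichmueller (a * b)"
proof
  fix n
  let ?a = "mpoly_var a :: ('a, int) mpoly" and ?b = "mpoly_var b :: ('a, int) mpoly"
  have "witt_mult p (teichmueller ?a) (teichmueller ?b) = teichmueller (?a * ?b)"
    using p by (intro ghost_inj[of p])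
      (simp_all add: ghost_simps ghost_teichmueller prime_gt_0_nat power_mult_distrib)
  then have "specialize (witt_mult p (teichmueller ?a) (teichmueller ?b) n) = specialize (teichmueller (?a * ?b) n)"
    by (simp only:)
  then show "witt_mult p (teichmueller a) (teichmueller b) n = teichmueller (a * b) n"
    by (simp add: specialize_simps mpoly_eval.hom_mult)
qed

lemma witt_verschiebung_add:
  assumes p: "prime p"
  shows "witt_add p (vseq x) (vseq y) = vseq (witt_add p x y)"
proof
  fix n
  have "witt_add p (vseq (generic x)) (vseq (generic y)) = vseq (witt_add p (generic x) (generic y))"
    using p by (intro ghost_inj[of p])
      (simp_all add: ghost_simps ghost_verschiebung prime_gt_0_nat distrib_left split: nat.split)
  then have "specialize (witt_add p (vseq (generic x)) (vseq (generic y)) n) =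
      specialize (vseq (witt_add p (generic x) (generic y)) n)" by (simp only:)
  then show "witt_add p (vseq x) (vseq y) n = vseq (witt_add p x y) n"
    by (simp add: specialize_simps)
qed

text \<open>From index 1 on, both sides have ghost components p^2 times a product. This places
  squares of elements of V W(S) in p V W(S), which drives
  \<open>power_congruence_versch\<close>.\<close>

lemma witt_verschiebung_mult:
  assumes p: "prime p"
  shows "witt_mult p (vseq x) (vseq y) = witt_nsmul p p (vseq (witt_mult p x y))"
proof
  fix n
  have "witt_mult p (vseq (generic x)) (vseq (generic y)) =
      witt_nsmul p p (vseq (witt_mult p (generic x) (generic y)))"
    using p by (intro ghost_inj[of p])
      (simp_all add: ghost_simps ghost_verschiebung prime_gt_0_nat mult_ac split: nat.split)
  then have "specialize (witt_mult p (vseq (generic x)) (vseq (generic y)) n) =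
      specialize (witt_nsmul p p (vseq (witt_mult p (generic x) (generic y))) n)" by (simp only:)
  then show "witt_mult p (vseq x) (vseq y) n = witt_nsmul p p (vseq (witt_mult p x y)) n"
    by (simp add: specialize_simps)
qed

lemma witt_teichmueller_add_verschiebung:
  assumes p: "prime p"
  shows "witt_add p (teichmueller (x 0)) (vseq (\<lambda>i. x (Suc i))) = x"
proof
  fix n
  have "witt_add p (teichmueller (generic x 0)) (vseq (\<lambda>i. generic x (Suc i))) = generic x"
    using p ghost_add_shift[of p _ "generic x"] by (intro ghost_inj[of p]) (simp_all add: ghost_simps prime_gt_0_nat)
  then have "specialize (witt_add p (teichmueller (generic x 0)) (vseq (\<lambda>i. generic x (Suc i))) n) = specialize (generic x n)"
    by (simp only:)
  then show "witt_add p (teichmueller (x 0)) (vseq (\<lambda>i. x (Suc i))) n = x n"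
    by (simp add: specialize_simps)
qed

text \<open>For generic \<open>x\<close> both sides agree modulo \<open>p\<close> only: their ghost components differ by \<open>p\<^sup>n\<^sup>+\<^sup>1 x\<^sub>n\<close>.\<close>

lemma witt_verschiebung_frobenius:
  fixes x :: "nat \<Rightarrow> 'a::comm_ring_1"
  assumes p: "prime p" and char: "CHAR('a) = p"
  shows "vseq (\<lambda>i. x i ^ p) = witt_nsmul p p x"
proof
  fix n
  let ?l = "vseq (\<lambda>i. generic x i ^ p)" and ?r = "witt_nsmul p p (generic x)"
  have p0: "p > 0" using p by (rule prime_gt_0_nat)
  have "of_nat (p ^ Suc n) dvd ghost p n ?l - ghost p n ?r" for n
  proof (cases n)
    case 0
    then show ?thesis using ghost_witt_nsmul[OF p, of 0 p "generic x"] by simp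
  next
    case (Suc k)
    have "ghost p n ?l = of_nat p * ghost p k (\<lambda>i. generic x i ^ p)"
      using p0 by (simp add: Suc ghost_verschiebung)
    moreover have "ghost p n ?r = of_nat p * (ghost p k (\<lambda>i. generic x i ^ p) + of_nat (p ^ n) * generic x n)"
      unfolding Suc by (subst ghost_witt_nsmul[OF p], subst ghost_Suc, rule refl)
    ultimately have "ghost p n ?l - ghost p n ?r = - (of_nat p * of_nat (p ^ n) * generic x n)"
      by (simp add: algebra_simps del: of_nat_power)
    then show ?thesis by (simp del: of_nat_power)
  qed
  then have "of_nat p dvd ?l n - ?r n"
    using ghost_cong_iff[OF p0, of ?l ?r] by blast
  then have "specialize (?l n) = specialize (?r n)"
    by (rule specialize_cong[OF char])
  then show "vseq (\<lambda>i. x i ^ p) n = witt_nsmul p p x n"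
    by (simp add: specialize_simps mpoly_eval.hom_power)
qed


section \<open>The ring of Witt vectors as a type\<close>

text \<open>A class instance cannot carry the prime as a parameter, so the prime is read off the
  coefficient type.\<close>

datatype 'a witt = Witt (witt_nth: "nat \<Rightarrow> 'a")

text \<open>If the characteristic is not prime, the choice of \<open>2\<close> is arbitrary; it only makes the type a ring.\<close>

definition witt_prime :: "'a::comm_ring_1 itself \<Rightarrow> nat" where
  "witt_prime _ = (if prime CHAR('a) then CHAR('a) else 2)"

lemma prime_witt_prime [simp]: "prime (witt_prime TYPE('a::comm_ring_1))"
  by (simp add: witt_prime_def)

lemma witt_prime_neq_0 [simp]: "witt_prime TYPE('a::comm_ring_1) \<noteq> 0"
  using prime_gt_0_nat[OF prime_witt_prime[where 'a = 'a]] by simp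

instantiation witt :: (comm_ring_1) comm_ring_1
begin

definition zero_witt :: "'a witt" where "0 = Witt (\<lambda>_. 0)"
definition one_witt :: "'a witt" where "1 = Witt (teichmueller 1)"
definition plus_witt :: "'a witt \<Rightarrow> 'a witt \<Rightarrow> 'a witt" where
  "x + y = Witt (witt_add (witt_prime TYPE('a)) (witt_nth x) (witt_nth y))"
definition times_witt :: "'a witt \<Rightarrow> 'a witt \<Rightarrow> 'a witt" where
  "x * y = Witt (witt_mult (witt_prime TYPE('a)) (witt_nth x) (witt_nth y))"
definition uminus_witt :: "'a witt \<Rightarrow> 'a witt" where
  "- x = Witt (witt_uminus (witt_prime TYPE('a)) (witt_nth x))"
definition minus_witt :: "'a witt \<Rightarrow> 'a witt \<Rightarrow> 'a witt" where
  "minus_witt x y = x + - (y :: 'a witt)"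

instance
proof
  fix x y z :: "'a witt"
  show "x + y + z = x + (y + z)" by (simp add: plus_witt_def witt_add_assoc)
  show "x + y = y + x" by (simp add: plus_witt_def witt_add_commute)
  show "0 + x = x" by (simp add: plus_witt_def zero_witt_def witt_add_zero)
  show "- x + x = 0" by (simp add: plus_witt_def zero_witt_def uminus_witt_def witt_add_uminus)
  show "x - y = x + - y" by (rule minus_witt_def)
  show "x * y * z = x * (y * z)" by (simp add: times_witt_def witt_mult_assoc)
  show "x * y = y * x" by (simp add: times_witt_def witt_mult_commute)
  show "1 * x = x" by (simp add: times_witt_def one_witt_def witt_mult_one)
  show "(x + y) * z = x * z + y * z" by (simp add: times_witt_def plus_witt_def witt_distrib)
  show "(0 :: 'a witt) \<noteq> 1" by (simp add: zero_witt_def one_witt_def teichmueller_def fun_eq_iff)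
qed

end

lemma of_nat_witt_mult:
  "of_nat k * x = Witt (witt_nsmul (witt_prime TYPE('a)) k (witt_nth (x :: 'a::comm_ring_1 witt)))"
proof (induction k)
  case 0
  then show ?case by (simp flip: zero_witt_def)
next
  case (Suc k)
  have "of_nat (Suc k) * x = x + of_nat k * x" by (simp add: distrib_right)
  then show ?case by (simp only: Suc plus_witt_def witt_nsmul.simps witt.sel)
qed

definition teich :: "'a::comm_ring_1 \<Rightarrow> 'a witt" where
  "teich a = Witt (teichmueller a)"

text \<open>Componentwise p-th powers give the Witt vector Frobenius in prime characteristic p, the
  setting of \<open>frob_hom\<close>.\<close>

definition frob :: "'a::comm_ring_1 witt \<Rightarrow> 'a witt" where
  "frob x = Witt (\<lambda>i. witt_nth x i ^ witt_prime TYPE('a))"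

definition versch :: "'a::comm_ring_1 witt \<Rightarrow> 'a witt" where
  "versch x = Witt (vseq (witt_nth x))"

definition wshift :: "'a witt \<Rightarrow> 'a witt" where
  "wshift x = Witt (\<lambda>i. witt_nth x (Suc i))"

text \<open>Reduction W(S) -> S. Its kernel is V W(S), by \<open>versch_wshift\<close> and
  \<open>const_term_versch\<close>.\<close>

definition const_term :: "'a witt \<Rightarrow> 'a" where
  "const_term x = witt_nth x 0"

interpretation const_term: unital_ring_hom "const_term :: 'a::comm_ring_1 witt \<Rightarrow> 'a"
proof
  fix x y :: "'a witt"
  let ?p = "witt_prime TYPE('a)"
  show "const_term (x + y) = const_term x + const_term y"
    using ghost_witt_add[of ?p 0 "witt_nth x" "witt_nth y"] by (simp add: const_term_def plus_witt_def)
  show "const_term (x * y) = const_term x * const_term y"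
    using ghost_witt_mult[of ?p 0 "witt_nth x" "witt_nth y"] by (simp add: const_term_def times_witt_def)
  show "const_term (1 :: 'a witt) = 1"
    by (simp add: const_term_def one_witt_def teichmueller_def)
qed

lemma const_term_teich [simp]: "const_term (teich a) = a"
  by (simp add: const_term_def teich_def teichmueller_def)

lemma const_term_versch [simp]: "const_term (versch x) = 0"
  by (simp add: const_term_def versch_def)

lemma const_term_frob: "const_term (frob x) = const_term x ^ witt_prime TYPE('a)" for x :: "'a::comm_ring_1 witt"
  by (simp add: const_term_def frob_def)

lemma witt_teich_add_versch: "teich (const_term x) + versch (wshift x) = x"
  by (simp add: teich_def const_term_def versch_def wshift_def plus_witt_def witt_teichmueller_add_verschiebung)

lemma versch_wshift: "const_term x = 0 \<Longrightarrow> versch (wshift x) = x"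
  by (cases x) (auto simp: const_term_def versch_def wshift_def vseq_def split: nat.split)

lemma teich_mult: "teich (a * b) = teich a * teich b"
  by (simp add: teich_def times_witt_def witt_mult_teichmueller)

lemma teich_one: "teich 1 = 1"
  by (simp add: teich_def one_witt_def)

lemma teich_power: "teich (a ^ n) = teich a ^ n"
  by (induction n) (simp_all add: teich_one teich_mult)

lemma versch_add: "versch (x + y) = versch x + versch y"
  by (simp add: versch_def plus_witt_def witt_verschiebung_add)

lemma versch_zero [simp]: "versch 0 = 0"
  using versch_add[of 0 0] by simp

lemma versch_mult: "versch x * versch y = of_nat (witt_prime TYPE('a)) * versch (x * y)" for x :: "'a::comm_ring_1 witt"
  unfolding of_nat_witt_mult by (simp add: versch_def times_witt_def witt_verschiebung_mult)

lemma versch_sum: "versch (sum f A) = (\<Sum>i\<in>A. versch (f i))"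
  by (induction A rule: infinite_finite_induct) (simp_all add: versch_add)

lemma funpow_versch_add: "(versch ^^ n) (x + y) = (versch ^^ n) x + (versch ^^ n) y"
  by (induction n) (simp_all add: versch_add)

lemma funpow_versch_sum: "(versch ^^ n) (sum f A) = (\<Sum>i\<in>A. (versch ^^ n) (f i))"
  by (induction n) (simp_all add: versch_sum)

lemma frob_versch_commute: "frob (versch x) = versch (frob x)"
  by (simp add: frob_def versch_def vseq_def fun_eq_iff power_0_left split: nat.split)

lemma frob_teich: "frob (teich a) = teich (a ^ witt_prime TYPE('a))" for a :: "'a::comm_ring_1"
  by (simp add: frob_def teich_def teichmueller_def fun_eq_iff power_0_left)

context
  fixes p :: nat
  assumes prime_char: "prime CHAR('a::comm_ring_1)" and p_def: "p = CHAR('a)"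
begin

lemma witt_prime_char: "witt_prime TYPE('a) = p"
  using prime_char p_def by (simp add: witt_prime_def)

lemma power_char_hom: "unital_ring_hom (\<lambda>x::'a. x ^ p)"
  using prime_char p_def by unfold_locales (simp_all add: freshmans_dream power_mult_distrib)

text \<open>Functoriality: in characteristic p the map x -> x^p is a ring homomorphism and so
  commutes with the Witt polynomials.\<close>

lemma frob_hom: "unital_ring_hom (frob :: 'a witt \<Rightarrow> 'a witt)"
proof -
  interpret pc: unital_ring_hom "\<lambda>x::'a. x ^ p" by (rule power_char_hom)
  show ?thesis
    by unfold_locales
      (simp_all add: frob_def witt_prime_char plus_witt_def times_witt_def one_witt_def
        pc.hom_witt_add pc.hom_witt_mult pc.hom_teichmueller)
qed

lemma versch_frob: "versch (frob x) = of_nat p * (x :: 'a witt)"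
  using prime_char p_def
  by (simp add: versch_def frob_def of_nat_witt_mult witt_prime_char witt_verschiebung_frobenius)

lemma frob_versch: "frob (versch x) = of_nat p * (x :: 'a witt)"
  by (simp add: frob_versch_commute versch_frob)

lemma const_term_of_nat_char [simp]: "const_term (of_nat p * x :: 'a witt) = 0"
  by (simp add: p_def const_term.hom_mult)

end

text \<open>Multiplication by p is VF; V is a shift, and F is injective because p-th powers are
  injective on a domain of characteristic p.\<close>

lemma of_nat_char_witt_cancel:
  fixes x :: "'a::idom witt"
  assumes "prime CHAR('a)" "of_nat CHAR('a) * x = of_nat CHAR('a) * y"
  shows "x = y"
proof -
  interpret pc: unital_ring_hom "\<lambda>x::'a. x ^ CHAR('a)"
    using assms(1) by (rule power_char_hom) simp
  have "versch (frob x) = versch (frob y)"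
    using assms by (simp add: versch_frob)
  then have "vseq (\<lambda>i. witt_nth x i ^ CHAR('a)) (Suc i) = vseq (\<lambda>i. witt_nth y i ^ CHAR('a)) (Suc i)" for i
    using assms(1) by (simp add: versch_def frob_def witt_prime_def)
  then have "(witt_nth x i - witt_nth y i) ^ CHAR('a) = 0" for i
    by (simp add: pc.hom_diff)
  then have "witt_nth x i = witt_nth y i" for i by simp
  then show ?thesis by (auto intro: witt.expand)
qed

text \<open>If x = y + q Vz, then x^p - y^p = (x - y)(p y^(p-1) + (x - y) w). The first summand
  contributes p q Vz y^(p-1), the second q^2 (Vz)^2 w with (Vz)^2 = p V(z^2); both lie in p q V
  W(S).\<close>

lemma power_congruence_versch:
  fixes u v :: "'a::comm_ring_1 witt"
  assumes char: "prime CHAR('a)" "p = CHAR('a)" and "const_term u = const_term v"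
  shows "\<exists>z. u ^ (p ^ n) = v ^ (p ^ n) + of_nat (p ^ n) * versch z"
proof (induction n)
  case 0
  have "versch (wshift (u - v)) = u - v"
    using assms by (intro versch_wshift) (simp add: const_term.hom_diff)
  then show ?case by (intro exI[of _ "wshift (u - v)"]) simp
next
  case (Suc n)
  let ?q = "of_nat (p ^ n) :: 'a witt"
  define x y where "x = u ^ (p ^ n)" and "y = v ^ (p ^ n)"
  obtain z where z: "x = y + ?q * versch z" using Suc unfolding x_def y_def by blast
  have p0: "p > 0" using char by (simp add: prime_gt_0_nat)
  have geo: "\<exists>w. (\<Sum>i<p. y ^ (p - Suc i) * x ^ i) = of_nat p * y ^ (p - 1) + (x - y) * w"
  proof -
    have "x - y dvd (\<Sum>i<p. y ^ (p - Suc i) * (x ^ i - y ^ i))"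
      by (intro dvd_sum dvd_mult) (simp add: power_diff_sumr2)
    then obtain w where "(\<Sum>i<p. y ^ (p - Suc i) * (x ^ i - y ^ i)) = (x - y) * w" by (rule dvdE)
    moreover have "(\<Sum>i<p. y ^ (p - Suc i) * y ^ i) = (\<Sum>i<p. y ^ (p - 1))"
      by (intro sum.cong refl) (simp flip: power_add)
    ultimately have "(\<Sum>i<p. y ^ (p - Suc i) * x ^ i) - of_nat p * y ^ (p - 1) = (x - y) * w"
      by (simp add: right_diff_distrib sum_subtractf)
    then show ?thesis by (metis add.commute diff_add_cancel)
  qed
  then obtain w where w: "(\<Sum>i<p. y ^ (p - Suc i) * x ^ i) = of_nat p * y ^ (p - 1) + (x - y) * w" by blast
  have xy: "x - y = ?q * versch z" by (simp add: z)
  \<comment> \<open>The cofactor of p q in x^p - y^p. Its constant term is 0, which puts it in the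
    image of V.\<close>
  define t where "t = versch z * y ^ (p - 1) + ?q * versch (z * z) * w"
  have "x ^ p - y ^ p = (x - y) * (of_nat p * y ^ (p - 1) + (x - y) * w)"
    by (simp only: power_diff_sumr2 w)
  also have "\<dots> = of_nat p * ?q * (versch z * y ^ (p - 1)) + ?q * ?q * (versch z * versch z) * w"
    unfolding xy by (simp add: algebra_simps del: of_nat_power)
  also have "versch z * versch z = of_nat p * versch (z * z)"
    using char by (simp add: versch_mult witt_prime_def)
  finally have "x ^ p - y ^ p = of_nat p * ?q * t"
    unfolding t_def by (simp add: algebra_simps del: of_nat_power)
  moreover have "const_term t = 0"
    by (simp add: t_def const_term.hom_add const_term.hom_mult)
  then have "t = versch (wshift t)" by (simp add: versch_wshift)
  ultimately have "x ^ p = y ^ p + of_nat (p ^ Suc n) * versch (wshift t)"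
    by (simp add: algebra_simps)
  moreover have "x ^ p = u ^ (p ^ Suc n)" "y ^ p = v ^ (p ^ Suc n)"
    by (simp_all only: x_def y_def power_mult[symmetric] power_Suc2)
  ultimately show ?case by auto
qed


section \<open>Witt vectors over subrings\<close>

text \<open>S is a subset of a larger polynomial ring, so closure properties are statements about
  sets. The locale serves S, W(S), W(k) and T alike.\<close>

locale subring_set =
  fixes S :: "'a::comm_ring_1 set"
  assumes one_mem: "1 \<in> S"
    and add_mem: "x \<in> S \<Longrightarrow> y \<in> S \<Longrightarrow> x + y \<in> S"
    and mult_mem: "x \<in> S \<Longrightarrow> y \<in> S \<Longrightarrow> x * y \<in> S"
    and uminus_mem: "x \<in> S \<Longrightarrow> - x \<in> S"
begin

lemma zero_mem: "0 \<in> S"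
  using add_mem[OF one_mem uminus_mem[OF one_mem]] by simp

lemma diff_mem: "x \<in> S \<Longrightarrow> y \<in> S \<Longrightarrow> x - y \<in> S"
  using add_mem uminus_mem by (metis diff_conv_add_uminus)

lemma power_mem: "x \<in> S \<Longrightarrow> x ^ n \<in> S"
  by (induction n) (auto intro: one_mem mult_mem)

lemma sum_mem: "(\<And>i. i \<in> A \<Longrightarrow> f i \<in> S) \<Longrightarrow> sum f A \<in> S"
  by (induction A rule: infinite_finite_induct) (auto intro: zero_mem add_mem)

lemma prod_mem: "(\<And>i. i \<in> A \<Longrightarrow> f i \<in> S) \<Longrightarrow> prod f A \<in> S"
  by (induction A rule: infinite_finite_induct) (auto intro: one_mem mult_mem)

lemma of_nat_mem: "of_nat n \<in> S"
  by (induction n) (auto intro: zero_mem one_mem add_mem)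

lemma of_int_mem: "of_int n \<in> S"
  using diff_mem[OF of_nat_mem of_nat_mem] by (cases n rule: int_diff_cases) simp

lemma mpoly_eval_mem: "(\<And>v. x v \<in> S) \<Longrightarrow> mpoly_eval x f \<in> S"
  unfolding mpoly_eval_def by (intro sum_mem mult_mem of_int_mem prod_mem power_mem)

lemma witt_add_mem: "(\<And>i. x i \<in> S) \<Longrightarrow> (\<And>i. y i \<in> S) \<Longrightarrow> witt_add p x y n \<in> S"
  unfolding witt_add_def by (intro mpoly_eval_mem) (simp split: sum.split)

lemma witt_mult_mem: "(\<And>i. x i \<in> S) \<Longrightarrow> (\<And>i. y i \<in> S) \<Longrightarrow> witt_mult p x y n \<in> S"
  unfolding witt_mult_def by (intro mpoly_eval_mem) (simp split: sum.split)

lemma witt_uminus_mem: "(\<And>i. x i \<in> S) \<Longrightarrow> witt_uminus p x n \<in> S"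
  unfolding witt_uminus_def by (intro mpoly_eval_mem)

lemma teichmueller_mem: "a \<in> S \<Longrightarrow> teichmueller a n \<in> S"
  by (simp add: teichmueller_def zero_mem)

lemma subring_set_witt: "subring_set {w. \<forall>i. witt_nth w i \<in> S}"
  by unfold_locales
    (simp_all add: one_witt_def plus_witt_def times_witt_def uminus_witt_def
      teichmueller_mem one_mem witt_add_mem witt_mult_mem witt_uminus_mem)

lemma power_diff_factor:
  assumes "x \<in> S" "y \<in> S"
  shows "\<exists>r\<in>S. x ^ n - y ^ n = (x - y) * r"
  using assms by (intro bexI[of _ "\<Sum>i<n. y ^ (n - Suc i) * x ^ i"])
    (simp_all add: power_diff_sumr2 sum_mem mult_mem power_mem)

text \<open>The term linear in y is kept apart because it will carry the main contribution. In each
  remaining term y occurs at least twice and p divides the binomial coefficient; for p = 2 none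
  remains.\<close>

lemma binomial_prime_expansion:
  assumes p: "prime p" and xy: "x \<in> S" "y \<in> S"
  shows "\<exists>r\<in>S. (x + y) ^ p = x ^ p + y ^ p + of_nat p * (x ^ (p - 1) * y) + of_nat p * (y ^ 2 * r)"
proof -
  let ?f = "\<lambda>k. of_nat (p choose k) * x ^ k * y ^ (p - k)"
  have p2: "p \<ge> 2" using p by (rule prime_ge_2_nat)
  have "\<exists>r\<in>S. ?f k = of_nat p * (y ^ 2 * r)" if "k \<in> {..p} - {0, p, p - 1}" for k
  proof -
    from that have k: "0 < k" "k < p" "p - k = 2 + (p - k - 2)" by auto
    then have "p dvd p choose k" using p by (intro dvd_choose_prime) auto
    then obtain c where c: "p choose k = p * c" by (rule dvdE)
    have "?f k = of_nat (p * c) * x ^ k * y ^ (2 + (p - k - 2))" using c k(3) by simp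
    also have "\<dots> = of_nat p * (y ^ 2 * (of_nat c * x ^ k * y ^ (p - k - 2)))"
      by (simp only: of_nat_mult power_add mult_ac)
    finally show ?thesis using xy by (blast intro: mult_mem power_mem of_nat_mem)
  qed
  then obtain r where r: "\<And>k. k \<in> {..p} - {0, p, p - 1} \<Longrightarrow> r k \<in> S \<and> ?f k = of_nat p * (y ^ 2 * r k)"
    by metis
  have "(x + y) ^ p = (\<Sum>k\<le>p. ?f k)" by (rule binomial_ring)
  also have "\<dots> = (\<Sum>k\<in>{..p} - {0, p, p - 1}. ?f k) + (\<Sum>k\<in>{0, p, p - 1}. ?f k)"
    by (rule sum.subset_diff) auto
  also have "(\<Sum>k\<in>{0, p, p - 1}. ?f k) = y ^ p + (x ^ p + of_nat p * (x ^ (p - 1) * y))"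
    using p2 by (auto simp: choose_one binomial_symmetric[of "p - 1" p, simplified] algebra_simps)
  also have "(\<Sum>k\<in>{..p} - {0, p, p - 1}. ?f k) =
      of_nat p * (y ^ 2 * (\<Sum>k\<in>{..p} - {0, p, p - 1}. r k))"
    using r by (simp add: sum_distrib_left)
  finally show ?thesis
    using r by (intro bexI[of _ "\<Sum>k\<in>{..p} - {0, p, p - 1}. r k"])
      (simp_all only: sum_mem add_ac)
qed

end

section \<open>Comparison of \<open>witt_ring\<close> with the type of Witt vectors\<close>

context
  fixes p :: nat and S :: "'a::comm_ring_1 set"
  assumes p: "p = witt_prime TYPE('a)" and S: "subring_set S"
begin

interpretation S: subring_set S by (rule S)

lemma witt_ring_add: "x \<oplus>\<^bsub>witt_ring p S\<^esub> y = witt_nth (Witt x + Witt y)"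
  by (simp add: witt_ring_def plus_witt_def witt_add_def p fun_eq_iff)

lemma witt_ring_zero: "\<zero>\<^bsub>witt_ring p S\<^esub> = witt_nth 0"
  by (simp add: witt_ring_def zero_witt_def)

lemma witt_ring_carrier: "x \<in> carrier (witt_ring p S) \<longleftrightarrow> Witt x \<in> {w. \<forall>i. witt_nth w i \<in> S}"
  by (simp add: witt_ring_def)

interpretation W: subring_set "{w. \<forall>i. witt_nth w i \<in> S}"
  by (rule S.subring_set_witt)

lemma abelian_group_witt_ring: "abelian_group (witt_ring p S)"
proof (rule abelian_groupI)
  fix x assume x: "x \<in> carrier (witt_ring p S)"
  show "\<exists>y\<in>carrier (witt_ring p S). y \<oplus>\<^bsub>witt_ring p S\<^esub> x = \<zero>\<^bsub>witt_ring p S\<^esub>"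
    using W.uminus_mem[of "Witt x"] x
    by (intro bexI[of _ "witt_nth (- Witt x)"])
      (simp_all only: witt_ring_carrier witt_ring_add witt_ring_zero witt.collapse ab_left_minus)
qed (simp_all only: witt_ring_carrier witt_ring_add witt_ring_zero witt.collapse
      W.add_mem W.zero_mem add_0 witt.sel add_ac)

lemma witt_ring_finsum:
  assumes "finite A" "\<And>i. i \<in> A \<Longrightarrow> f i \<in> carrier (witt_ring p S)"
  shows "finsum (witt_ring p S) f A = witt_nth (\<Sum>i\<in>A. Witt (f i))"
proof -
  interpret abelian_group "witt_ring p S" by (rule abelian_group_witt_ring)
  show ?thesis
    using assms
    by (induction A rule: finite_induct) (simp_all add: witt_ring_zero witt_ring_add Pi_def)
qed

lemma witt_ring_minus:
  assumes "x \<in> carrier (witt_ring p S)" "y \<in> carrier (witt_ring p S)"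
  shows "x \<ominus>\<^bsub>witt_ring p S\<^esub> y = witt_nth (Witt x - Witt y)"
proof -
  interpret abelian_group "witt_ring p S" by (rule abelian_group_witt_ring)
  have "\<ominus>\<^bsub>witt_ring p S\<^esub> y = witt_nth (- Witt y)"
    using assms W.uminus_mem[of "Witt y"]
    by (intro minus_equality)
      (simp_all only: witt_ring_carrier witt_ring_add witt_ring_zero witt.collapse ab_left_minus)
  then show ?thesis by (simp add: a_minus_def witt_ring_add)
qed

end

section \<open>The polynomial ring S and the maps \<open>witt_delta\<close> on it\<close>

lemma keys_uminus [simp]: "Poly_Mapping.keys (- f) = Poly_Mapping.keys f"
  by (auto simp: in_keys_iff)

lemma subring_set_poly_ring: "subring_set (poly_ring N :: (nat, 'k::comm_ring_1) mpoly set)"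
proof
  fix f g :: "(nat, 'k) mpoly"
  show "1 \<in> (poly_ring N :: (nat, 'k) mpoly set)" by (simp add: poly_ring_def)
  assume f: "f \<in> poly_ring N"
  show "- f \<in> poly_ring N" using f by (simp add: poly_ring_def)
  assume g: "g \<in> poly_ring N"
  show "f + g \<in> poly_ring N"
    using f g keys_add[of f g] by (auto simp: poly_ring_def)
  show "f * g \<in> poly_ring N"
    unfolding poly_ring_def
  proof (rule CollectI, rule ballI)
    fix m assume "m \<in> Poly_Mapping.keys (f * g)"
    then obtain a b where "a \<in> Poly_Mapping.keys f" "b \<in> Poly_Mapping.keys g" "m = a + b"
      using keys_mult[of f g] by blast
    then show "Poly_Mapping.keys m \<subseteq> {1..N}"
      using f g keys_add[of a b] unfolding poly_ring_def by blast
  qed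
qed

lemma single_mem_poly_ring:
  "f \<in> poly_ring N \<Longrightarrow> m \<in> Poly_Mapping.keys f \<Longrightarrow> Poly_Mapping.single m c \<in> poly_ring N"
  by (auto simp: poly_ring_def)

lemma subring_set_range_single_0:
  "subring_set (range (Poly_Mapping.single 0) :: ('v, 'k::comm_ring_1) mpoly set)"
proof
  show "1 \<in> (range (Poly_Mapping.single 0) :: ('v, 'k) mpoly set)"
    by (metis rangeI single_one)
qed (auto simp: mult_single simp flip: single_add single_uminus)

lemma CHAR_mpoly: "CHAR(('v, 'k::comm_ring_1) mpoly) = CHAR('k)"
proof (rule CHAR_eqI)
  have *: "(of_nat n :: ('v, 'k) mpoly) = Poly_Mapping.single 0 (of_nat n)" for n
    by simp
  show "of_nat CHAR('k) = (0 :: ('v, 'k) mpoly)" unfolding * by (simp del: single_of_nat)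
  fix n assume "of_nat n = (0 :: ('v, 'k) mpoly)"
  then have "Poly_Mapping.lookup (of_nat n :: ('v, 'k) mpoly) 0 = 0" by simp
  then show "CHAR('k) dvd n" by (simp add: lookup_of_nat of_nat_eq_0_iff_char_dvd)
qed

text \<open>This is A_0 for \<open>a\<close>; \<open>teich a\<close> minus it is the vector of the
  delta_i.\<close>

definition monomial_lift :: "('v, 'k::comm_ring_1) mpoly \<Rightarrow> ('v, 'k) mpoly witt" where
  "monomial_lift a = (\<Sum>m\<in>Poly_Mapping.keys a. teich (Poly_Mapping.single m (Poly_Mapping.lookup a m)))"

lemma const_term_monomial_lift [simp]: "const_term (monomial_lift a) = a"
  by (simp add: monomial_lift_def const_term.hom_sum sum_single_lookup)

lemma witt_delta_eq:
  fixes a :: "(nat, 'k::comm_ring_1) mpoly"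
  assumes "prime CHAR('k)" "p = CHAR('k)" "a \<in> poly_ring N"
  shows "witt_delta p (poly_ring N) i a = witt_nth (teich a - monomial_lift a) i"
proof -
  let ?S = "poly_ring N :: (nat, 'k) mpoly set"
  note S = subring_set_poly_ring[of N, where 'k = 'k]
  have p: "p = witt_prime TYPE((nat, 'k) mpoly)"
    using assms by (simp add: witt_prime_def CHAR_mpoly)
  have teich: "teichmueller b \<in> carrier (witt_ring p ?S)" if "b \<in> ?S" for b
    using that by (simp add: witt_ring_def subring_set.teichmueller_mem[OF S])
  have sum: "finsum (witt_ring p ?S) (\<lambda>m. teichmueller (Poly_Mapping.single m (Poly_Mapping.lookup a m))) (Poly_Mapping.keys a) =
      witt_nth (monomial_lift a)"
    using assms(3) by (subst witt_ring_finsum[OF p S])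
      (auto simp: monomial_lift_def teich_def intro: teich single_mem_poly_ring)
  interpret abelian_group "witt_ring p ?S" by (rule abelian_group_witt_ring[OF p S])
  have "witt_nth (monomial_lift a) \<in> carrier (witt_ring p ?S)"
    unfolding sum[symmetric] using assms(3)
    by (intro finsum_closed) (auto intro: teich single_mem_poly_ring)
  then show ?thesis
    unfolding witt_delta_def sum
    by (subst witt_ring_minus[OF p S]) (simp_all add: teich assms(3) teich_def)
qed

lemma witt_delta_mem:
  assumes "prime CHAR('k)" "p = CHAR('k)" "(a :: (nat, 'k::comm_ring_1) mpoly) \<in> poly_ring N"
  shows "witt_delta p (poly_ring N) i a \<in> poly_ring N"
proof -
  interpret S: subring_set "poly_ring N :: (nat, 'k) mpoly set" by (rule subring_set_poly_ring)
  interpret W: subring_set "{w. \<forall>i. witt_nth w i \<in> (poly_ring N :: (nat, 'k) mpoly set)}"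
    by (rule S.subring_set_witt)
  have "teich b \<in> {w. \<forall>i. witt_nth w i \<in> poly_ring N}" if "b \<in> poly_ring N" for b :: "(nat, 'k) mpoly"
    using that by (simp add: teich_def S.teichmueller_mem)
  then have "teich a - monomial_lift a \<in> {w. \<forall>i. witt_nth w i \<in> poly_ring N}"
    using assms(3) unfolding monomial_lift_def
    by (intro W.diff_mem W.sum_mem) (auto intro: single_mem_poly_ring)
  then show ?thesis using assms by (simp add: witt_delta_eq)
qed


section \<open>The image of polynomials over \<open>W(k)\<close>\<close>

text \<open>The subring \<open>W(k)\<close> of \<open>W(k[x])\<close>.\<close>

definition const_witt :: "('v, 'k::comm_ring_1) mpoly witt set" where
  "const_witt = {w. \<forall>i. witt_nth w i \<in> range (Poly_Mapping.single 0)}"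

interpretation const_witt: subring_set const_witt
  unfolding const_witt_def by (rule subring_set.subring_set_witt[OF subring_set_range_single_0])

definition tmon :: "('v \<Rightarrow>\<^sub>0 nat) \<Rightarrow> ('v, 'k::comm_ring_1) mpoly witt" where
  "tmon m = teich (Poly_Mapping.single m 1)"

lemma tmon_0: "tmon 0 = 1"
  by (simp add: tmon_def teich_one)

lemma tmon_add: "tmon (m + n) = tmon m * tmon n"
  by (simp add: tmon_def mult_single flip: teich_mult)

text \<open>This is T, as the W(k)-span of the Teichmueller monomials in x_1, ..., x_N. Adding one
  term at a time yields a simple induction; a monomial may occur repeatedly.\<close>

inductive_set span_teich :: "nat \<Rightarrow> (nat, 'k::comm_ring_1) mpoly witt set" for N where
  span_zero: "0 \<in> span_teich N"
| span_step: "c \<in> const_witt \<Longrightarrow> Poly_Mapping.keys m \<subseteq> {1..N} \<Longrightarrow> t \<in> span_teich N \<Longrightarrow>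
    c * tmon m + t \<in> span_teich N"

lemma span_add: "t \<in> span_teich N \<Longrightarrow> u \<in> span_teich N \<Longrightarrow> t + u \<in> span_teich N"
  by (induction rule: span_teich.induct) (simp_all only: add_0 add.assoc span_step)

lemma span_monomial: "c \<in> const_witt \<Longrightarrow> Poly_Mapping.keys m \<subseteq> {1..N} \<Longrightarrow> c * tmon m \<in> span_teich N"
  using span_step[OF _ _ span_zero] by simp

lemma span_uminus: "t \<in> span_teich N \<Longrightarrow> - t \<in> span_teich N"
proof (induction rule: span_teich.induct)
  case (span_step c m t)
  have "- (c * tmon m + t) = (- c) * tmon m + - t" by simp
  then show ?case
    using span_step by (simp only: span_teich.span_step const_witt.uminus_mem)
qed (simp add: span_zero)

lemma span_mult_monomial:
  assumes "c \<in> const_witt" "Poly_Mapping.keys m \<subseteq> {1..N}"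
  shows "t \<in> span_teich N \<Longrightarrow> c * tmon m * t \<in> span_teich N"
proof (induction rule: span_teich.induct)
  case (span_step d n t)
  have "c * tmon m * (d * tmon n + t) = (c * d) * tmon (m + n) + c * tmon m * t"
    by (simp add: tmon_add algebra_simps)
  moreover have "Poly_Mapping.keys (m + n) \<subseteq> {1..N}"
    using keys_add[of m n] assms(2) span_step.hyps(2) by blast
  ultimately show ?case
    using span_step assms by (simp only: span_teich.span_step const_witt.mult_mem)
qed (simp add: span_zero)

lemma span_mult: "t \<in> span_teich N \<Longrightarrow> u \<in> span_teich N \<Longrightarrow> t * u \<in> span_teich N"
  by (induction rule: span_teich.induct)
    (simp_all add: span_zero distrib_right span_add span_mult_monomial)

interpretation span: subring_set "span_teich N"
proof
  show "1 \<in> span_teich N"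
    using span_monomial[OF const_witt.one_mem, of 0 N] by (simp add: tmon_0)
qed (simp_all add: span_add span_mult span_uminus)

lemma const_term_span: "t \<in> span_teich N \<Longrightarrow> const_term t \<in> poly_ring N"
proof (induction rule: span_teich.induct)
  case span_zero
  then show ?case by (simp add: subring_set.zero_mem[OF subring_set_poly_ring])
next
  case (span_step c m t)
  obtain d where "const_term c = Poly_Mapping.single 0 d"
    using span_step(1) unfolding const_witt_def const_term_def by blast
  then have "const_term (c * tmon m + t) = Poly_Mapping.single m d + const_term t"
    by (simp add: const_term.hom_add const_term.hom_mult tmon_def mult_single)
  moreover have "Poly_Mapping.single m d \<in> poly_ring N"
    using span_step(2) by (simp add: poly_ring_def)
  ultimately show ?case
    using span_step.IH by (simp only: subring_set.add_mem[OF subring_set_poly_ring])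
qed

lemma span_teich_single:
  fixes c :: "'k::comm_ring_1"
  assumes "Poly_Mapping.keys m \<subseteq> {1..N}"
  shows "teich (Poly_Mapping.single m c) \<in> span_teich N"
proof -
  have "teich (Poly_Mapping.single m c) = teich (Poly_Mapping.single 0 c) * tmon m"
    by (simp add: tmon_def mult_single flip: teich_mult)
  moreover have "(teich (Poly_Mapping.single 0 c) :: (nat, 'k) mpoly witt) \<in> const_witt"
    using subring_set.teichmueller_mem[OF subring_set_range_single_0, of "Poly_Mapping.single 0 c"]
    by (auto simp: const_witt_def teich_def)
  ultimately show ?thesis using assms by (simp only: span_monomial)
qed

lemma span_monomial_lift:
  assumes "a \<in> poly_ring N"
  shows "monomial_lift a \<in> span_teich N"
  using assms unfolding monomial_lift_def poly_ring_def by (intro span.sum_mem span_teich_single) blast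

text \<open>Equal monomials are collected, so that in \<open>span_divide\<close> a vanishing
  constant term forces every coefficient to reduce to 0.\<close>

lemma span_normal_form:
  assumes "t \<in> span_teich N"
  obtains A c where "finite A" "\<And>m. m \<in> A \<Longrightarrow> Poly_Mapping.keys m \<subseteq> {1..N}"
    "\<And>m. c m \<in> const_witt" "t = (\<Sum>m\<in>A. c m * tmon m)"
proof -
  have "\<exists>A c. finite A \<and> (\<forall>m\<in>A. Poly_Mapping.keys m \<subseteq> {1..N}) \<and> (\<forall>m. c m \<in> const_witt) \<and>
      t = (\<Sum>m\<in>A. c m * tmon m)"
    using assms
  proof (induction rule: span_teich.induct)
    case span_zero
    show ?case by (intro exI[of _ "{}"] exI[of _ "\<lambda>_. 0"]) (simp add: const_witt.zero_mem)
  next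
    case (span_step d n t)
    then obtain A c where A: "finite A" "\<forall>m\<in>A. Poly_Mapping.keys m \<subseteq> {1..N}"
      and c: "\<forall>m. c m \<in> const_witt" and t: "t = (\<Sum>m\<in>A. c m * tmon m)"
      by blast
    \<comment> \<open>If \<open>n\<close> is not in \<open>A\<close>, the old \<open>c n\<close>
      does not occur in \<open>t\<close> and must be dropped; hence the default 0.\<close>
    define c' where "c' = c(n := d + (if n \<in> A then c n else 0))"
    have rest: "(\<Sum>m\<in>A - {n}. c' m * tmon m) = (\<Sum>m\<in>A - {n}. c m * tmon m)"
      by (intro sum.cong) (auto simp: c'_def)
    have "(\<Sum>m\<in>insert n A. c' m * tmon m) = c' n * tmon n + (\<Sum>m\<in>A - {n}. c m * tmon m)"
      using A(1) by (simp add: sum.insert_remove rest)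
    also have "\<dots> = d * tmon n + t"
    proof (cases "n \<in> A")
      case True
      then show ?thesis
        using A(1) by (simp add: t c'_def sum.remove[of A n] distrib_right add.assoc)
    qed (simp add: t c'_def)
    finally have "d * tmon n + t = (\<Sum>m\<in>insert n A. c' m * tmon m)" by (rule sym)
    moreover have "\<forall>m. c' m \<in> const_witt"
      using c span_step.hyps(1) by (simp add: c'_def const_witt.add_mem const_witt.zero_mem)
    ultimately show ?case
      using A span_step.hyps(2) by (intro exI[of _ "insert n A"] exI[of _ c']) simp
  qed
  then show ?thesis using that by blast
qed

section \<open>Division by \<open>p\<close> and the expansion of Teichmueller lifts\<close>

text \<open>This is A_s: the recursion of \<open>witt_Delta\<close> with its last summand lifted to
  T, while the arguments delta_(s-r)(a) stay polynomials.\<close>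

fun Delta_lift :: "nat \<Rightarrow> (nat, 'k::comm_ring_1) mpoly set \<Rightarrow> nat \<Rightarrow> (nat, 'k) mpoly \<Rightarrow> (nat, 'k) mpoly witt" where
  "Delta_lift p S s a =
     (\<Sum>r\<in>{1..<s}. Delta_lift p S r (witt_delta p S (s - r) a)) + monomial_lift (witt_delta p S s a)"

declare Delta_lift.simps [simp del]

lemma const_term_Delta_lift: "const_term (Delta_lift p S s a) = witt_Delta p S s a"
proof (induction s arbitrary: a rule: less_induct)
  case (less s)
  then show ?case
    by (subst Delta_lift.simps, subst witt_Delta.simps)
      (simp add: const_term.hom_add const_term.hom_sum)
qed

context
  fixes p :: nat
  assumes prime_char: "prime CHAR('k::field)" and p_def: "p = CHAR('k)"
begin

lemma CHAR_poly: "CHAR((nat, 'k) mpoly) = p"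
  by (simp add: CHAR_mpoly p_def)

lemma prime_CHAR_poly: "prime CHAR((nat, 'k) mpoly)"
  using prime_char by (simp add: CHAR_mpoly)

lemma prime_p: "prime p"
  using prime_char by (simp add: p_def)

lemma witt_prime_poly: "witt_prime TYPE((nat, 'k) mpoly) = p"
  by (rule witt_prime_char[OF prime_CHAR_poly CHAR_poly[symmetric]])

interpretation frob: unital_ring_hom "frob :: (nat, 'k) mpoly witt \<Rightarrow> _"
  by (rule frob_hom[OF prime_CHAR_poly refl])

lemma frob_versch_poly: "frob (versch x) = of_nat p * (x :: (nat, 'k) mpoly witt)"
  by (rule frob_versch[OF prime_CHAR_poly CHAR_poly[symmetric]])

lemma frob_tmon: "frob (tmon m :: (nat, 'k) mpoly witt) = tmon m ^ p"
  by (simp add: tmon_def frob_teich witt_prime_poly teich_power)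

lemma tmon_power: "\<exists>m'. Poly_Mapping.keys m' \<subseteq> Poly_Mapping.keys m \<and> (tmon m :: (nat, 'k) mpoly witt) ^ n = tmon m'"
proof (induction n)
  case 0
  show ?case by (intro exI[of _ 0]) (simp add: tmon_0)
next
  case (Suc n)
  then obtain m' where m': "Poly_Mapping.keys m' \<subseteq> Poly_Mapping.keys m" "(tmon m :: (nat, 'k) mpoly witt) ^ n = tmon m'"
    by blast
  then show ?case
    using keys_add[of m m'] by (intro exI[of _ "m + m'"]) (auto simp: tmon_add)
qed

lemma frob_const_witt:
  assumes "c \<in> (const_witt :: (nat, 'k) mpoly witt set)"
  shows "frob c \<in> const_witt"
  using assms subring_set.power_mem[OF subring_set_range_single_0[where 'v = nat and 'k = 'k]]
  by (simp add: const_witt_def frob_def)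

lemma frob_span: "t \<in> span_teich N \<Longrightarrow> frob t \<in> (span_teich N :: (nat, 'k) mpoly witt set)"
proof (induction rule: span_teich.induct)
  case (span_step c m t)
  obtain m' where m': "Poly_Mapping.keys m' \<subseteq> Poly_Mapping.keys m" "(tmon m :: (nat, 'k) mpoly witt) ^ p = tmon m'"
    using tmon_power by blast
  have "frob (c * tmon m + t) = frob c * tmon m' + frob t"
    by (simp add: frob.hom_add frob.hom_mult frob_tmon m'(2))
  moreover have "Poly_Mapping.keys m' \<subseteq> {1..N}" using m'(1) span_step.hyps(2) by blast
  ultimately show ?case
    using span_step by (simp only: span_teich.span_step frob_const_witt)
qed (simp add: span_zero)

lemma funpow_frob_span: "t \<in> span_teich N \<Longrightarrow> (frob ^^ n) t \<in> (span_teich N :: (nat, 'k) mpoly witt set)"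
  by (induction n) (simp_all add: frob_span)

lemma funpow_frob_hom: "unital_ring_hom (frob ^^ n :: (nat, 'k) mpoly witt \<Rightarrow> _)"
proof
  show "(frob ^^ n) (x + y) = (frob ^^ n) x + (frob ^^ n) y" for x y :: "(nat, 'k) mpoly witt"
    by (induction n) (simp_all add: frob.hom_add)
  show "(frob ^^ n) (x * y) = (frob ^^ n) x * (frob ^^ n) y" for x y :: "(nat, 'k) mpoly witt"
    by (induction n) (simp_all add: frob.hom_mult)
  show "(frob ^^ n) (1 :: (nat, 'k) mpoly witt) = 1"
    by (induction n) simp_all
qed

text \<open>Each of the n copies of V meets one F and becomes a factor p; j copies of F
  survive.\<close>

lemma funpow_frob_versch:
  "(frob ^^ (j + n)) ((versch ^^ n) x) = of_nat (p ^ n) * (frob ^^ j) (x :: (nat, 'k) mpoly witt)"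
proof (induction n)
  case (Suc n)
  interpret fn: unital_ring_hom "frob ^^ (j + n) :: (nat, 'k) mpoly witt \<Rightarrow> _" by (rule funpow_frob_hom)
  have "(frob ^^ (j + Suc n)) ((versch ^^ Suc n) x) = (frob ^^ (j + n)) (frob (versch ((versch ^^ n) x)))"
    by (simp add: funpow_swap1)
  also have "\<dots> = of_nat p * (frob ^^ (j + n)) ((versch ^^ n) x)"
    by (simp add: frob_versch_poly fn.hom_mult)
  finally show ?case by (simp add: Suc mult.assoc)
qed simp

lemma const_term_of_nat_p: "const_term (of_nat p * x :: (nat, 'k) mpoly witt) = 0"
  by (rule const_term_of_nat_char[OF prime_CHAR_poly CHAR_poly[symmetric]])

lemma of_nat_p_cancel: "of_nat p * x = of_nat p * y \<Longrightarrow> x = (y :: (nat, 'k) mpoly witt)"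
  using of_nat_char_witt_cancel[OF prime_CHAR_poly, of x y] by (simp add: CHAR_poly)

context
  assumes perfect: "surj (\<lambda>c::'k. c ^ p)"
begin

text \<open>A vanishing constant term means c = V(c'). As k is perfect, the components of c' have
  p-th roots in k, so c' = F(w) and c = VF(w) = p w.\<close>

lemma const_witt_divide:
  assumes "(c :: (nat, 'k) mpoly witt) \<in> const_witt" "const_term c = 0"
  shows "\<exists>w\<in>const_witt. c = of_nat p * w"
proof -
  have "\<exists>d. witt_nth c (Suc i) = Poly_Mapping.single 0 (d ^ p)" for i
  proof -
    obtain e where "witt_nth c (Suc i) = Poly_Mapping.single 0 e"
      using assms(1) unfolding const_witt_def by blast
    moreover obtain d where "e = d ^ p" using perfect by (metis surjD)
    ultimately show ?thesis by blast
  qed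
  then obtain d where d: "\<And>i. witt_nth c (Suc i) = Poly_Mapping.single 0 (d i ^ p)" by metis
  define w :: "(nat, 'k) mpoly witt" where "w = Witt (\<lambda>i. Poly_Mapping.single 0 (d i))"
  have pow: "Poly_Mapping.single 0 (x ^ n) = (Poly_Mapping.single 0 x :: (nat, 'k) mpoly) ^ n" for x n
    by (induction n) (simp_all flip: mult_single[of 0 _ 0, simplified])
  have "c = versch (wshift c)" using assms(2) by (simp add: versch_wshift)
  also have "wshift c = frob w"
    by (simp add: wshift_def frob_def w_def d pow witt_prime_poly)
  also have "versch (frob w) = of_nat p * w"
    by (rule versch_frob[OF prime_CHAR_poly CHAR_poly[symmetric]])
  finally have "c = of_nat p * w" .
  moreover have "w \<in> const_witt" by (simp add: w_def const_witt_def)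
  ultimately show ?thesis by blast
qed

text \<open>In normal form the constant terms are scalar multiples of distinct monomials, so a zero
  sum makes every scalar 0 and every coefficient divisible by p in W(k). Thus elements of T in V
  W(S) lie in p T.\<close>

lemma span_divide:
  assumes "(t :: (nat, 'k) mpoly witt) \<in> span_teich N" "const_term t = 0"
  shows "\<exists>u\<in>span_teich N. t = of_nat p * u"
proof -
  obtain A c where A: "finite A" "\<And>m. m \<in> A \<Longrightarrow> Poly_Mapping.keys m \<subseteq> {1..N}"
    and c: "\<And>m. c m \<in> const_witt" and t: "t = (\<Sum>m\<in>A. c m * tmon m)"
    using span_normal_form[OF assms(1)] by blast
  have "\<exists>d. const_term (c m) = Poly_Mapping.single 0 d" for m
    using c[of m] unfolding const_witt_def const_term_def by blast
  then obtain d where d: "\<And>m. const_term (c m) = Poly_Mapping.single 0 (d m)"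
    by metis
  have zero: "(\<Sum>m\<in>A. Poly_Mapping.single m (d m)) = 0"
    using assms(2) by (simp add: t const_term.hom_sum const_term.hom_mult tmon_def d mult_single)
  have d0: "d n = 0" if "n \<in> A" for n
    using arg_cong[OF zero, of "\<lambda>f. Poly_Mapping.lookup f n"] that A(1)
    by (simp add: lookup_sum lookup_single when_def sum.delta)
  have "\<exists>w. w \<in> const_witt \<and> c m = of_nat p * w" if "m \<in> A" for m
    using const_witt_divide[OF c[of m]] d[of m] d0[OF that] by auto
  then obtain w where w: "\<And>m. m \<in> A \<Longrightarrow> w m \<in> const_witt \<and> c m = of_nat p * w m"
    by (metis (no_types))
  have "t = of_nat p * (\<Sum>m\<in>A. w m * tmon m)"
    using w by (simp add: t sum_distrib_left mult.assoc)
  moreover have "(\<Sum>m\<in>A. w m * tmon m) \<in> span_teich N"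
    using w A(2) by (intro span.sum_mem span_monomial) auto
  ultimately show ?thesis by blast
qed

text \<open>The constant term of F(t) is the p-th power of that of t, so if p divides F(t), then t =
  p u with u in T; cancel p and repeat. The quotient \<open>c\<close>, at first any Witt vector, is
  thereby placed in F(T).\<close>

lemma span_frob_divide:
  assumes "(t :: (nat, 'k) mpoly witt) \<in> span_teich N" "frob t = of_nat (p ^ n) * c"
  shows "\<exists>u\<in>span_teich N. c = frob u"
  using assms
proof (induction n arbitrary: t)
  case (Suc n)
  have "const_term t ^ p = const_term (frob t)"
    by (simp add: const_term_frob witt_prime_poly)
  also have "\<dots> = 0"
    using const_term_of_nat_p[of "of_nat (p ^ n) * c"] Suc.prems(2) by (simp add: mult.assoc)
  finally obtain u where u: "u \<in> span_teich N" "t = of_nat p * u"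
    using span_divide[OF Suc.prems(1)] by auto
  have "of_nat p * frob u = of_nat p * (of_nat (p ^ n) * c)"
    using Suc.prems(2) by (simp add: u(2) frob.hom_mult mult.assoc)
  then show ?case using Suc.IH[OF u(1)] of_nat_p_cancel by blast
qed auto

text \<open>t^p and F(t) have the same constant term, so \<open>span_divide\<close> applies to their
  difference.\<close>

lemma span_frobenius_lift:
  assumes "(t :: (nat, 'k) mpoly witt) \<in> span_teich N"
  shows "\<exists>d\<in>span_teich N. t ^ p = frob t + of_nat p * d"
proof -
  have "\<exists>d\<in>span_teich N. t ^ p - frob t = of_nat p * d"
    using assms
    by (intro span_divide span.diff_mem span.power_mem frob_span)
      (simp_all add: const_term.hom_diff const_term.hom_power const_term_frob witt_prime_poly)
  then show ?thesis by (metis add.commute diff_add_cancel)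
qed

text \<open>In the induction step the right-hand side \<open>F(b) + q c\<close> is raised to the power \<open>p\<close>. For \<open>p = q = 2\<close> the term
  \<open>(q c)\<^sup>p\<close> is not divisible by \<open>p\<^sup>2 q\<close>, but \<open>c\<^sup>p \<equiv> F(c)\<close> modulo \<open>p\<close>, so it is absorbed into \<open>F(b)\<close>.\<close>

lemma span_power_expansion:
  assumes t: "(t :: (nat, 'k) mpoly witt) \<in> span_teich N" and d: "d \<in> span_teich N"
    and td: "t ^ p = frob t + of_nat p * d"
  shows "\<exists>b\<in>span_teich N. \<exists>e\<in>span_teich N.
    t ^ (p ^ Suc k) = frob b + of_nat (p ^ Suc k) * (t ^ (p ^ Suc k - p) * d + of_nat p * e)"
proof (induction k)
  case 0
  \<comment> \<open>For q = p the exponent q - p is 0 and the claim is \<open>td\<close> with b =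
    t.\<close>
  show ?case using t td by (intro bexI[of _ t] bexI[of _ 0]) (simp_all add: span.zero_mem)
next
  case (Suc k)
  let ?q = "p ^ Suc k" and ?P = "of_nat p :: (nat, 'k) mpoly witt"
  let ?Q = "of_nat (p ^ Suc k) :: (nat, 'k) mpoly witt"
  obtain b e where b: "b \<in> span_teich N" and e: "e \<in> span_teich N"
    and eq: "t ^ ?q = frob b + ?Q * (t ^ (?q - p) * d + ?P * e)"
    using Suc by blast
  define c where "c = t ^ (?q - p) * d + ?P * e"
  have c: "c \<in> span_teich N" unfolding c_def
    by (intro span.add_mem span.mult_mem span.power_mem span.of_nat_mem t d e)
  have y: "?Q * c \<in> span_teich N" by (intro span.mult_mem span.of_nat_mem c)
  have Fb: "frob b \<in> span_teich N" by (rule frob_span[OF b])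
  have tq: "t ^ ?q = frob b + ?Q * c" using eq by (simp only: c_def)
  have p2: "p \<ge> 2" using prime_p by (rule prime_ge_2_nat)
  obtain r where r: "r \<in> span_teich N"
    "(frob b + ?Q * c) ^ p = frob b ^ p + (?Q * c) ^ p + ?P * (frob b ^ (p - 1) * (?Q * c)) + ?P * ((?Q * c) ^ 2 * r)"
    using span.binomial_prime_expansion[OF prime_p Fb y] by blast
  \<comment> \<open>As t^q and F(b) differ by q c, F(b)^(p-1) can be traded for t^(q(p-1)) up to a
    multiple of p. This factor raises the exponent of t in the main term.\<close>
  obtain h0 where h0: "h0 \<in> span_teich N"
    "frob b ^ (p - 1) - (t ^ ?q) ^ (p - 1) = (frob b - t ^ ?q) * h0"
    using span.power_diff_factor[OF Fb span.power_mem[OF t]] by blast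
  define h where "h = - (of_nat (p ^ k) * c * h0)"
  have h: "h \<in> span_teich N" unfolding h_def
    by (intro span.uminus_mem span.mult_mem span.of_nat_mem c h0)
  have Q: "?Q = ?P * of_nat (p ^ k)" by simp
  have bp: "frob b ^ (p - 1) = t ^ (?q * (p - 1)) + ?P * h"
  proof -
    have "frob b ^ (p - 1) - (t ^ ?q) ^ (p - 1) = ?P * h"
      unfolding h0(2) unfolding tq h_def by (simp add: mult.assoc)
    then show ?thesis by (simp only: power_mult) (simp only: diff_eq_eq add.commute)
  qed
  obtain d' where d': "d' \<in> span_teich N" "c ^ p = frob c + ?P * d'"
    using span_frobenius_lift[OF c] by blast
  \<comment> \<open>Since p >= 2, q^2 divides q^p, hence so does p q; the cofactor \<open>s\<close>
    enters the error term.\<close>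
  obtain j where "p = 2 + j" using le_Suc_ex[OF p2] by blast
  then have "?q ^ p = ?q ^ (2 + j)" by (rule arg_cong)
  also have "\<dots> = ?q * (p * (p ^ k * ?q ^ j))"
    by (simp only: power_add power2_eq_square power_Suc mult_ac)
  finally have "\<exists>s. ?q ^ p = ?q * (p * s)" by blast
  then obtain s where s: "?q ^ p = ?q * (p * s)" by blast
  have yp: "(?Q * c) ^ p = frob (of_nat (?q ^ p) * c) + ?P * ?Q * (?P * (of_nat s * d'))"
  proof -
    have "(?Q * c) ^ p = of_nat (?q ^ p) * (frob c + ?P * d')"
      by (simp only: power_mult_distrib d'(2) of_nat_power)
    also have "\<dots> = frob (of_nat (?q ^ p) * c) + of_nat (?q ^ p) * (?P * d')"
      by (simp only: frob.hom_mult frob.hom_of_nat distrib_left)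
    also have "of_nat (?q ^ p) * (?P * d') = ?P * ?Q * (?P * (of_nat s * d'))"
      unfolding s by (simp only: of_nat_mult mult_ac)
    finally show ?thesis .
  qed
  \<comment> \<open>\<open>b'\<close> gathers what lies under F. \<open>e'\<close> gathers the old
    error, the correction by \<open>h\<close>, the remainder of (q c)^p and the terms quadratic in q
    c.\<close>
  define b' where "b' = b ^ p + of_nat (?q ^ p) * c"
  define e' where "e' = t ^ (?q * (p - 1)) * e + h * c + of_nat s * d' + of_nat (p ^ k) * c ^ 2 * r"
  have exp: "t ^ (?q * (p - 1)) * t ^ (?q - p) = t ^ (p ^ Suc (Suc k) - p)"
  proof -
    have "p \<le> ?q" using p2 by simp
    moreover have "?q * p = ?q * (p - 1) + ?q" using p2 by (simp add: diff_mult_distrib2)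
    ultimately have "?q * (p - 1) + (?q - p) = p ^ Suc (Suc k) - p"
      by (simp add: mult_ac)
    then show ?thesis by (simp only: power_add[symmetric])
  qed
  have "t ^ (p ^ Suc (Suc k)) = (t ^ ?q) ^ p"
    by (simp only: power_mult[symmetric] power_Suc2)
  also have "\<dots> = frob b ^ p + (?Q * c) ^ p + ?P * (frob b ^ (p - 1) * (?Q * c)) + ?P * ((?Q * c) ^ 2 * r)"
    unfolding tq by (rule r(2))
  also have "frob b ^ p = frob (b ^ p)" by (simp only: frob.hom_power)
  also have "frob (b ^ p) + (?Q * c) ^ p = frob b' + ?P * ?Q * (?P * (of_nat s * d'))"
    by (simp only: yp b'_def frob.hom_add add.assoc)
  also have "?P * (frob b ^ (p - 1) * (?Q * c)) =
      ?P * ?Q * (t ^ (?q * (p - 1)) * t ^ (?q - p) * d + ?P * (t ^ (?q * (p - 1)) * e + h * c))"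
    by (simp only: bp) (simp only: c_def algebra_simps)
  also have "?P * ((?Q * c) ^ 2 * r) = ?P * ?Q * (?P * (of_nat (p ^ k) * c ^ 2 * r))"
    by (simp only: power2_eq_square Q mult_ac)
  also have "frob b' + ?P * ?Q * (?P * (of_nat s * d')) +
      ?P * ?Q * (t ^ (?q * (p - 1)) * t ^ (?q - p) * d + ?P * (t ^ (?q * (p - 1)) * e + h * c)) +
      ?P * ?Q * (?P * (of_nat (p ^ k) * c ^ 2 * r)) =
      frob b' + ?P * ?Q * (t ^ (?q * (p - 1)) * t ^ (?q - p) * d + ?P * e')"
    by (simp only: e'_def distrib_left add_ac)
  also have "?P * ?Q = of_nat (p ^ Suc (Suc k))" by simp
  finally have "t ^ (p ^ Suc (Suc k)) =
      frob b' + of_nat (p ^ Suc (Suc k)) * (t ^ (p ^ Suc (Suc k) - p) * d + ?P * e')"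
    by (simp only: exp)
  moreover have "b' \<in> span_teich N" unfolding b'_def
    by (intro span.add_mem span.mult_mem span.power_mem span.of_nat_mem b c)
  moreover have "e' \<in> span_teich N" unfolding e'_def
    by (intro span.add_mem span.mult_mem span.power_mem span.of_nat_mem t e h c d' r)
  ultimately show ?case by blast
qed

section \<open>The expansion of [a] by powers of V and the resulting form of Delta_s\<close>

lemma Delta_lift_span:
  assumes "(a :: (nat, 'k) mpoly) \<in> poly_ring N"
  shows "Delta_lift p (poly_ring N) s a \<in> span_teich N"
  using assms
proof (induction s arbitrary: a rule: less_induct)
  case (less s)
  note \<delta> = witt_delta_mem[OF prime_char p_def less.prems]
  have "(\<Sum>r\<in>{1..<s}. Delta_lift p (poly_ring N) r (witt_delta p (poly_ring N) (s - r) a)) \<in> span_teich N"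
    by (intro span.sum_mem less.IH \<delta>) simp
  then show ?case
    by (subst Delta_lift.simps) (intro span.add_mem span_monomial_lift \<delta>)
qed

text \<open>Iterates x = [x_0] + V(shift of x); a remainder in the image of V^n replaces the
  infinite sum.\<close>

lemma teichmueller_expansion_partial:
  "w = (\<Sum>i<n. (versch ^^ i) (teich (witt_nth w i))) + (versch ^^ n) ((wshift ^^ n) (w :: (nat, 'k) mpoly witt))"
proof (induction n)
  case (Suc n)
  have nth: "witt_nth ((wshift ^^ n) w) j = witt_nth w (n + j)" for j
    by (induction n arbitrary: j) (simp_all add: wshift_def)
  have "(wshift ^^ n) w = teich (witt_nth w n) + versch ((wshift ^^ Suc n) w)"
    using witt_teich_add_versch[of "(wshift ^^ n) w"] by (simp add: const_term_def nth)
  then have "(versch ^^ n) ((wshift ^^ n) w) =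
      (versch ^^ n) (teich (witt_nth w n)) + (versch ^^ Suc n) ((wshift ^^ Suc n) w)"
    by (simp only: funpow_versch_add funpow_Suc_right o_apply)
  then show ?case using Suc by (simp add: add.assoc)
qed simp

text \<open>[a] - A_0 is the sum of the V^i[delta_i(a)], and each [delta_i(a)] is expanded again by
  induction. Grouped by s = i + r, the terms V^(i+r) A_r(delta_i(a)) reproduce the recursion of
  \<open>Delta_lift\<close>.\<close>

lemma teich_expansion:
  assumes "(a :: (nat, 'k) mpoly) \<in> poly_ring N"
  shows "\<exists>z. teich a = monomial_lift a + (\<Sum>s=1..n. (versch ^^ s) (Delta_lift p (poly_ring N) s a)) +
    (versch ^^ Suc n) z"
  using assms
proof (induction n arbitrary: a rule: less_induct)
  case (less n)
  let ?S = "poly_ring N :: (nat, 'k) mpoly set"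
  let ?\<delta> = "\<lambda>i. witt_delta p ?S i a" and ?V = "\<lambda>i. versch ^^ i :: (nat, 'k) mpoly witt \<Rightarrow> _"
  define w where "w = teich a - monomial_lift a"
  have \<delta>: "?\<delta> i = witt_nth w i" for i
    unfolding w_def by (rule witt_delta_eq[OF prime_char p_def less.prems])
  \<comment> \<open>Component 0 vanishes, so the expansion starts at i = 1 and the induction
    hypothesis is used at smaller depth.\<close>
  have "const_term w = 0" by (simp add: w_def const_term.hom_diff)
  then have w0: "teich (witt_nth w 0) = 0"
    by (simp add: const_term_def teich_def teichmueller_def zero_witt_def fun_eq_iff)
  obtain z0 where "w = (\<Sum>i<Suc n. ?V i (teich (?\<delta> i))) + ?V (Suc n) z0"
    using teichmueller_expansion_partial[of w "Suc n"] unfolding \<delta> by blast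
  moreover have "(\<Sum>i<Suc n. ?V i (teich (?\<delta> i))) = (\<Sum>i=1..n. ?V i (teich (?\<delta> i)))"
    by (intro sum.mono_neutral_cong_right) (auto simp: \<delta> w0 Suc_le_eq not_less_eq_eq)
  ultimately have w: "w = (\<Sum>i=1..n. ?V i (teich (?\<delta> i))) + ?V (Suc n) z0" by simp
  \<comment> \<open>Depth n - i makes every remainder lie in the image of V^(n+1) once V^i is
    applied.\<close>
  define R where "R i z \<longleftrightarrow> teich (?\<delta> i) = monomial_lift (?\<delta> i) +
      (\<Sum>r=1..n - i. ?V r (Delta_lift p ?S r (?\<delta> i))) + ?V (Suc (n - i)) z" for i z
  have "\<exists>z. R i z" if "i \<in> {1..n}" for i
    unfolding R_def by (rule less.IH[OF _ witt_delta_mem[OF prime_char p_def less.prems]]) (use that in simp)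
  then obtain z where z: "\<And>i. i \<in> {1..n} \<Longrightarrow> R i (z i)" by metis
  have comp: "?V i (?V j x) = ?V (i + j) x" for i j x by (simp add: funpow_add)
  have "?V i (teich (?\<delta> i)) = ?V i (monomial_lift (?\<delta> i)) +
      (\<Sum>r=1..n - i. ?V (i + r) (Delta_lift p ?S r (?\<delta> i))) + ?V (Suc n) (z i)" if "i \<in> {1..n}" for i
  proof -
    have "i + Suc (n - i) = Suc n" using that by simp
    then show ?thesis
      unfolding z[OF that, unfolded R_def] by (simp only: funpow_versch_add funpow_versch_sum comp)
  qed
  then have "(\<Sum>i=1..n. ?V i (teich (?\<delta> i))) = (\<Sum>i=1..n. ?V i (monomial_lift (?\<delta> i)) +
      (\<Sum>r=1..n - i. ?V (i + r) (Delta_lift p ?S r (?\<delta> i))) + ?V (Suc n) (z i))"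
    by (intro sum.cong refl)
  also have "\<dots> = (\<Sum>i=1..n. ?V i (monomial_lift (?\<delta> i))) +
      (\<Sum>i=1..n. \<Sum>r=1..n - i. ?V (i + r) (Delta_lift p ?S r (?\<delta> i))) + ?V (Suc n) (\<Sum>i=1..n. z i)"
    by (simp only: sum.distrib funpow_versch_sum)
  \<comment> \<open>Reindexing by s = i + r; the condition i >= 1 becomes r < s.\<close>
  also have "(\<Sum>i=1..n. \<Sum>r=1..n - i. ?V (i + r) (Delta_lift p ?S r (?\<delta> i))) =
      (\<Sum>s=1..n. \<Sum>r\<in>{1..<s}. ?V s (Delta_lift p ?S r (?\<delta> (s - r))))"
    unfolding sum.Sigma[OF finite_atLeastAtMost ballI[OF finite_atLeastAtMost]]
      sum.Sigma[OF finite_atLeastAtMost ballI[OF finite_atLeastLessThan]]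
    by (rule sum.reindex_bij_witness[of _ "\<lambda>(s, r). (s - r, r)" "\<lambda>(i, r). (i + r, r)"]) auto
  also have "(\<Sum>i=1..n. ?V i (monomial_lift (?\<delta> i))) +
      (\<Sum>s=1..n. \<Sum>r\<in>{1..<s}. ?V s (Delta_lift p ?S r (?\<delta> (s - r)))) =
      (\<Sum>s=1..n. ?V s (Delta_lift p ?S s a))"
    by (subst (2) Delta_lift.simps) (simp only: funpow_versch_add funpow_versch_sum sum.distrib add.commute)
  finally have "w = (\<Sum>s=1..n. ?V s (Delta_lift p ?S s a)) + ?V (Suc n) ((\<Sum>i=1..n. z i) + z0)"
    using w by (simp only: funpow_versch_add add.assoc)
  then show ?case
    by (intro exI[of _ "(\<Sum>i=1..n. z i) + z0"]) (simp add: w_def diff_eq_eq add_ac)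
qed

text \<open>The witness D is the constant term of the \<open>d\<close> in A_0^p = F(A_0) + p d,
  chosen before s and hence common to all s.\<close>

lemma witt_Delta_expansion:
  assumes a: "(a :: (nat, 'k) mpoly) \<in> poly_ring N"
  shows "\<exists>D. \<forall>s\<ge>1. \<exists>g\<in>poly_ring N. witt_Delta p (poly_ring N) s a = a ^ (p ^ s - p) * D + g ^ p"
proof -
  let ?a = "monomial_lift a" and ?T = "Delta_lift p (poly_ring N)"
  have la: "?a \<in> span_teich N" by (rule span_monomial_lift[OF a])
  obtain d where d: "d \<in> span_teich N" "?a ^ p = frob ?a + of_nat p * d"
    using span_frobenius_lift[OF la] by blast
  have "\<exists>g\<in>poly_ring N. witt_Delta p (poly_ring N) s a = a ^ (p ^ s - p) * const_term d + g ^ p" if s: "s \<ge> 1" for s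
  proof -
    obtain k where k: "s = Suc k" using s by (cases s) auto
    let ?q = "of_nat (p ^ s) :: (nat, 'k) mpoly witt"
    interpret fs: unital_ring_hom "frob ^^ s :: (nat, 'k) mpoly witt \<Rightarrow> _" by (rule funpow_frob_hom)
    obtain z where z: "teich a = ?a + (\<Sum>r=1..s. (versch ^^ r) (?T r a)) + (versch ^^ Suc s) z"
      using teich_expansion[OF a] by blast
    have fp: "(frob ^^ s) ((versch ^^ r) x) = of_nat (p ^ r) * (frob ^^ (s - r)) x" if "r \<le> s" for r and x :: "(nat, 'k) mpoly witt"
      using funpow_frob_versch[of "s - r" r x] that by simp
    have teich_frob: "(frob ^^ n) (teich a) = teich a ^ (p ^ n)" for n
    proof (induction n)
      case (Suc n)
      then show ?case
        by (simp add: frob.hom_power frob_teich witt_prime_poly teich_power flip: power_mult)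
    qed simp
    \<comment> \<open>With s = k + 1, one F splits off every term of the expansion except the one
      with r = s; \<open>y\<close> is what stands under it.\<close>
    define y where "y = (frob ^^ k) ?a + (\<Sum>r=1..k. of_nat (p ^ r) * (frob ^^ (k - r)) (?T r a))"
    have y: "y \<in> span_teich N" unfolding y_def
      by (intro span.add_mem span.sum_mem span.mult_mem span.of_nat_mem funpow_frob_span la Delta_lift_span a)
    have "(frob ^^ s) (teich a) = (frob ^^ s) ?a + (\<Sum>r=1..s. of_nat (p ^ r) * (frob ^^ (s - r)) (?T r a)) +
        ?q * versch z"
    proof -
      have "(versch ^^ Suc s) z = (versch ^^ s) (versch z)" by (simp only: funpow_Suc_right o_apply)
      then show ?thesis
        by (subst z) (simp add: fs.hom_add fs.hom_sum fp del: funpow.simps of_nat_power)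
    qed
    also have "(\<Sum>r=1..s. of_nat (p ^ r) * (frob ^^ (s - r)) (?T r a)) =
        (\<Sum>r=1..k. of_nat (p ^ r) * (frob ^^ (s - r)) (?T r a)) + ?q * ?T s a"
      unfolding k by (subst sum.cl_ivl_Suc) simp
    also have "(\<Sum>r=1..k. of_nat (p ^ r) * (frob ^^ (s - r)) (?T r a)) =
        (\<Sum>r=1..k. frob (of_nat (p ^ r) * (frob ^^ (k - r)) (?T r a)))"
      by (intro sum.cong refl) (simp add: k Suc_diff_le frob.hom_mult del: of_nat_power)
    finally have F1: "teich a ^ (p ^ s) = frob y + ?q * ?T s a + ?q * versch z"
      unfolding teich_frob y_def frob.hom_add frob.hom_sum by (simp add: k algebra_simps)
    obtain z' where F2: "teich a ^ (p ^ s) = ?a ^ (p ^ s) + ?q * versch z'"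
      using power_congruence_versch[OF prime_CHAR_poly CHAR_poly[symmetric], of "teich a" ?a s] by auto
    obtain b e where b: "b \<in> span_teich N" and e: "e \<in> span_teich N"
      and F3: "?a ^ (p ^ s) = frob b + ?q * (?a ^ (p ^ s - p) * d + of_nat p * e)"
      using span_power_expansion[OF la d, of k] unfolding k by blast
    \<comment> \<open>Comparing \<open>F1\<close>, \<open>F2\<close> and \<open>F3\<close> gives F(b
      - y) = q c. In the constant term p e and both images of V vanish, so \<open>c\<close> reduces
      to the difference sought, while \<open>span_frob_divide\<close> makes it a value of F.\<close>
    define c where "c = ?T s a - ?a ^ (p ^ s - p) * d - of_nat p * e + versch z - versch z'"
    have "frob (b - y) = ?q * c"
      using F1 F2 F3 unfolding c_def frob.hom_diff by (simp add: algebra_simps del: of_nat_power)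
    then obtain u where u: "u \<in> span_teich N" "c = frob u"
      using span_frob_divide[OF span.diff_mem[OF b y]] by blast
    have "(of_nat p :: (nat, 'k) mpoly) = 0" using const_term_of_nat_p[of 1] by simp
    then have "const_term c = witt_Delta p (poly_ring N) s a - a ^ (p ^ s - p) * const_term d"
      by (simp add: c_def const_term.hom_add const_term.hom_diff const_term.hom_mult const_term.hom_power
          const_term_Delta_lift)
    moreover have "const_term c = const_term u ^ p"
      by (simp add: u(2) const_term_frob witt_prime_poly)
    ultimately show ?thesis
      using const_term_span[OF u(1)] by (intro bexI[of _ "const_term u"]) (simp_all add: algebra_simps)
  qed
  then show ?thesis by blast
qed

end

end

theorem theorem4:
  fixes p N s :: nat and S :: "(nat, 'k::field) mpoly set" and a :: "(nat, 'k) mpoly"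
  assumes char: "CHAR('k) = p" "p > 0"
    and perfect: "surj (\<lambda>c::'k. c ^ p)"
    and S_def: "S = poly_ring N"
    and "a \<in> S" and "s \<ge> 1"
  shows "witt_Delta p S s a - a ^ (p ^ s - p) * witt_Delta p S 1 a \<in> frobenius_image p S"
proof -
  have prime: "prime CHAR('k)" using char by (intro prime_CHAR_semidom) simp
  interpret S: subring_set "poly_ring N :: (nat, 'k) mpoly set" by (rule subring_set_poly_ring)
  interpret pow: unital_ring_hom "\<lambda>x :: (nat, 'k) mpoly. x ^ p"
    using prime by (intro power_char_hom) (simp_all add: CHAR_mpoly char(1))
  have a: "a \<in> poly_ring N" using assms by simp
  obtain D where D: "\<And>s. s \<ge> 1 \<Longrightarrow> \<exists>g\<in>poly_ring N. witt_Delta p (poly_ring N) s a = a ^ (p ^ s - p) * D + g ^ p"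
    using witt_Delta_expansion[OF prime char(1)[symmetric] perfect a] by blast
  obtain g where g: "g \<in> poly_ring N" "witt_Delta p (poly_ring N) s a = a ^ (p ^ s - p) * D + g ^ p"
    using D[OF \<open>s \<ge> 1\<close>] by blast
  \<comment> \<open>For s = 1 the exponent p^s - p is 0, so Delta_1(a) is D up to a p-th
    power.\<close>
  obtain g1 where g1: "g1 \<in> poly_ring N" "witt_Delta p (poly_ring N) 1 a = D + g1 ^ p"
    using D[of 1] by auto
  \<comment> \<open>The factor a^(p^s - p) is itself a p-th power, so replacing D by Delta_1(a)
    changes the product only by a p-th power; in characteristic p these combine into one.\<close>
  have "p ^ s - p = (p ^ (s - 1) - 1) * p"
    using \<open>s \<ge> 1\<close> by (cases s) (simp_all add: diff_mult_distrib2 mult.commute)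
  then have "a ^ (p ^ s - p) = (a ^ (p ^ (s - 1) - 1)) ^ p"
    by (simp only: power_mult)
  then have "witt_Delta p S s a - a ^ (p ^ s - p) * witt_Delta p S 1 a = (g - a ^ (p ^ (s - 1) - 1) * g1) ^ p"
    by (simp add: S_def g(2) g1(2)[unfolded One_nat_def] pow.hom_diff algebra_simps power_mult_distrib)
  moreover have "g - a ^ (p ^ (s - 1) - 1) * g1 \<in> S"
    unfolding S_def by (intro S.diff_mem S.mult_mem S.power_mem g(1) g1(1) a)
  ultimately show ?thesis unfolding frobenius_image_def by blast
qed

end
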